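(* Let $n\ge 3$, let $\mathcal{D}$ be a dissection of a convex $n$-gon $P_n$ into $m$ pieces, and let $W_{\mathcal{D}}(x;q)=(v_{i,j})_{1\le i,j\le n}$ be the associated weight matrix (with edge weights). Then $$v_{j,i}=\psi_{\mathcal{D}}(v_{i,j})\qquad\text{for all }1\le i,j\le n,$$ i.e. $W_{\mathcal{D}}(x;q)$ is complementary symmetric with respect to $\psi_{\mathcal{D}}$: $W_{\mathcal{D}}(x;q)^t=(\psi_{\mathcal{D}}(v_{i,j}))_{i,j}$.
   Context: $P_n$ is a convex $n$-gon ($n\ge3$) with vertices labelled $1,2,\ldots,n$ in counterclockwise order, labels being taken modulo $n$. A dissection $\mathcal{D}$ of $P_n$ is obtained by drawing $m-1$ ($m\ge 1$) pairwise noncrossing diagonals, which cut $P_n$ into $m$ polygons $\alpha_1,\ldots,\alpha_m$, called the pieces of the dissection; one writes $\mathcal{D}=\{\alpha_1,\ldots,\alpha_m\}$. If $\alpha_l$ has $d_l$ vertices, it is called a piece of degree $d_l$. For vertices $i,j$, a (counterclockwise) walk from $i$ to $j$ around $P_n$ is a sequence $w=(p_{i+1},p_{i+2},\ldots,p_{j-1})$ of pieces of $\mathcal{D}$, indexed by the vertices strictly between $i$ and $j$ when going counterclockwise from $i$ to $j$ (labels modulo $n$), such that: (i) $p_k$ is incident to vertex $k$ (i.e. $k$ is a vertex of $p_k$) for all $k\in\{i+1,\ldots,j-1\}$; (ii) each piece $\alpha\in\mathcal{D}$ of degree $d$ appears at most $d-2$ times among $p_{i+1},\ldots,p_{j-1}$.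 By convention, for $i=j$ there is no walk from $i$ to $i$; for $j=i+1$ (modulo $n$) the empty sequence is the unique walk from $i$ to $i+1$. To each piece $\alpha_l$ an indeterminate $x_l=x(\alpha_l)$ is associated, and to each boundary edge $e_i$ of $P_n$ joining $i$ and $i+1$ (modulo $n$) an indeterminate $q_i$. The weight of a walk $w=(p_{i+1},\ldots,p_{j-1})$ from $i$ to $j$ is the monomial $x^wq^w$ with $x^w=\prod_{k=i+1}^{j-1}x(p_k)$ and $q^w=\prod_{s=i}^{j-1}q_s$ (products taken counterclockwise from $i$ to $j$, indices modulo $n$; so $q^w$ is the product of the weights of the edges traversed). The weight matrix $W_{\mathcal{D}}(x;q)=W_{\mathcal{D}}(x_1,\ldots,x_m;q_1,\ldots,q_n)=(v_{i,j})_{1\le i,j\le n}$ has entries $v_{i,j}=\sum_w x^wq^w$, the sum over all walks $w$ from $i$ to $j$ (so $v_{i,i}=0$, $v_{i,i+1}=q_i$). Complementing map: let $\mathrm{Pol}_{\mathcal{D}}(x;q)$ be the set of $f\in\mathbb{Z}[x_1,\ldots,x_m;q_1,\ldots,q_n]$ with $\deg_{x_i}f\le d_i-2$ for all $i$ and $\deg_{q_j}f\le 1$ for all $j$. The linear map $\psi_{\mathcal{D}}:\mathrm{Pol}_{\mathcal{D}}(x;q)\to\mathrm{Pol}_{\mathcal{D}}(x;q)$ is defined on monomials by $\psi_{\mathcal{D}}\left(\prod_{i=1}^m x_i^{a_i}\prod_{j\in I}q_j\right)=\prod_{i=1}^m x_i^{d_i-2-a_i}\prod_{j\notin I}q_j$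 for $I\subseteq\{1,\ldots,n\}$, and extended linearly. *)

theory Defs
  imports "HOL-Library.Poly_Mapping"
begin

section \<open>Dissections of a convex polygon\<close>

text \<open>
  The vertices of the convex polygon \<open>P\<^sub>n\<close> are \<open>1, \<dots>, n\<close> in counterclockwise order.  Only
  this cyclic order matters, so a polygon is represented by its set of vertices.
\<close>

definition vertices :: "nat \<Rightarrow> nat set" where
  "vertices n = {1..n}"

text \<open>The representative in \<open>{1..n}\<close> of a label \<open>k \<ge> 1\<close> taken modulo \<open>n\<close>.\<close>

definition wrap :: "nat \<Rightarrow> nat \<Rightarrow> nat" where
  "wrap n k = (k - 1) mod n + 1"

text \<open>
  The diagonal joining \<open>a\<close> and \<open>b\<close>, where \<open>a < b\<close>, is the pair \<open>(a, b)\<close>.  The pair \<open>(1, n)\<close> is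
  excluded because it is a boundary edge.
\<close>

definition diagonals :: "nat \<Rightarrow> (nat \<times> nat) set" where
  "diagonals n = {(a, b). a \<in> vertices n \<and> b \<in> vertices n \<and> a + 1 < b \<and> (a, b) \<noteq> (1, n)}"

fun crosses :: "nat \<times> nat \<Rightarrow> nat \<times> nat \<Rightarrow> bool" where
  "crosses (a, b) (c, d) \<longleftrightarrow> (a < c \<and> c < b \<and> b < d) \<or> (c < a \<and> a < d \<and> d < b)"

definition noncrossing_diagonals :: "nat \<Rightarrow> (nat \<times> nat) set \<Rightarrow> bool" where
  "noncrossing_diagonals n \<Delta> \<longleftrightarrow>
     \<Delta> \<subseteq> diagonals n \<and> (\<forall>\<delta>\<in>\<Delta>. \<forall>\<epsilon>\<in>\<Delta>. \<not> crosses \<delta> \<epsilon>)"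

text \<open>
  A diagonal cuts \<open>P\<^sub>n\<close> into two polygons, both having the endpoints of the diagonal as vertices.
\<close>

fun side :: "nat \<Rightarrow> nat \<times> nat \<Rightarrow> bool \<Rightarrow> nat set" where
  "side n (a, b) True = {v \<in> vertices n. a \<le> v \<and> v \<le> b}"
| "side n (a, b) False = {v \<in> vertices n. v \<le> a \<or> b \<le> v}"

text \<open>
  The pieces into which the diagonals in \<open>\<Delta>\<close> cut \<open>P\<^sub>n\<close>: choose one of the two sides of every
  diagonal and intersect.  Since the diagonals do not cross, the vertices of such an
  intersection are vertices of \<open>P\<^sub>n\<close>; it is a genuine polygon (has nonempty interior) iff it has
  at least three vertices.  A piece is given by its set of vertices, so its degree is its
  cardinality and it is incident to its elements.
\<close>

definition pieces :: "nat \<Rightarrow> (nat \<times> nat) set \<Rightarrow> nat set set" where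
  "pieces n \<Delta> = {\<alpha>. 3 \<le> card \<alpha> \<and> (\<exists>s. \<alpha> = {v \<in> vertices n. \<forall>\<delta>\<in>\<Delta>. v \<in> side n \<delta> (s \<delta>)})}"

definition dissection :: "nat \<Rightarrow> nat \<Rightarrow> nat set set \<Rightarrow> bool" where
  "dissection n m \<D> \<longleftrightarrow>
     (\<exists>\<Delta>. noncrossing_diagonals n \<Delta> \<and> card \<Delta> + 1 = m \<and> \<D> = pieces n \<Delta>)"


section \<open>Walks\<close>

text \<open>The number of boundary edges from \<open>i\<close> counterclockwise to \<open>j\<close>, for \<open>i, j \<in> {1..n}\<close>.\<close>

definition steps :: "nat \<Rightarrow> nat \<Rightarrow> nat \<Rightarrow> nat" where
  "steps n i j = (j + n - i) mod n"

text \<open>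
  The entry \<open>w ! t\<close> of a walk \<open>w\<close> from \<open>i\<close> to \<open>j\<close> is the piece at the vertex \<open>i + 1 + t\<close>.  There
  are \<open>steps n i j - 1\<close> vertices strictly between \<open>i\<close> and \<open>j\<close>; the length condition is written
  without truncated subtraction, so that there is no walk from \<open>i\<close> to \<open>i\<close>.
\<close>

definition walks :: "nat \<Rightarrow> nat set set \<Rightarrow> nat \<Rightarrow> nat \<Rightarrow> nat set list set" where
  "walks n \<D> i j = {w. length w + 1 = steps n i j \<and> set w \<subseteq> \<D> \<and>
     (\<forall>t < length w. wrap n (i + 1 + t) \<in> w ! t) \<and>
     (\<forall>\<alpha>\<in>\<D>. count_list w \<alpha> \<le> card \<alpha> - 2)}"


section \<open>Weights\<close>

text \<open>
  Indeterminates: \<open>X \<alpha>\<close> for a piece \<open>\<alpha>\<close>, and \<open>Q k\<close> for the boundary edge joining \<open>k\<close> and \<open>k + 1\<close>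
  (modulo \<open>n\<close>).
\<close>

datatype indet = X "nat set" | Q nat

type_synonym monom = "indet \<Rightarrow>\<^sub>0 nat"
type_synonym mpoly = "monom \<Rightarrow>\<^sub>0 int"

definition Indet :: "indet \<Rightarrow> mpoly" where
  "Indet v = Poly_Mapping.single (Poly_Mapping.single v 1) 1"

definition walk_weight :: "nat \<Rightarrow> nat \<Rightarrow> nat \<Rightarrow> nat set list \<Rightarrow> mpoly" where
  "walk_weight n i j w =
     (\<Prod>t<length w. Indet (X (w ! t))) * (\<Prod>t<steps n i j. Indet (Q (wrap n (i + t))))"

text \<open>The matrix is a function of its row and column index, both ranging over \<open>{1..n}\<close>.\<close>

definition weight_matrix :: "nat \<Rightarrow> nat set set \<Rightarrow> nat \<Rightarrow> nat \<Rightarrow> mpoly" where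
  "weight_matrix n \<D> i j = (\<Sum>w\<in>walks n \<D> i j. walk_weight n i j w)"


section \<open>The complementing map\<close>

definition Pol :: "nat \<Rightarrow> nat set set \<Rightarrow> mpoly set" where
  "Pol n \<D> = {f. \<forall>\<mu>\<in>Poly_Mapping.keys f.
     Poly_Mapping.keys \<mu> \<subseteq> X ` \<D> \<union> Q ` {1..n} \<and>
     (\<forall>\<alpha>\<in>\<D>. Poly_Mapping.lookup \<mu> (X \<alpha>) \<le> card \<alpha> - 2) \<and>
     (\<forall>k\<in>{1..n}. Poly_Mapping.lookup \<mu> (Q k) \<le> 1)}"

definition compl_monom :: "nat \<Rightarrow> nat set set \<Rightarrow> monom \<Rightarrow> monom" where
  "compl_monom n \<D> \<mu> =
     (\<Sum>\<alpha>\<in>\<D>. Poly_Mapping.single (X \<alpha>) (card \<alpha> - 2 - Poly_Mapping.lookup \<mu> (X \<alpha>))) +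
     (\<Sum>k\<in>{1..n}. Poly_Mapping.single (Q k) (1 - Poly_Mapping.lookup \<mu> (Q k)))"

text \<open>
  The linear extension of \<open>compl_monom\<close>.  It is only meaningful on \<open>Pol n \<D>\<close>, where no subtraction
  in \<open>compl_monom\<close> is truncated; lemma \<open>weight_matrix_in_Pol\<close> below shows that the entries of the
  weight matrix lie there.
\<close>

definition psi :: "nat \<Rightarrow> nat set set \<Rightarrow> mpoly \<Rightarrow> mpoly" where
  "psi n \<D> f = (\<Sum>\<mu>\<in>Poly_Mapping.keys f.
     Poly_Mapping.single (compl_monom n \<D> \<mu>) (Poly_Mapping.lookup f \<mu>))"

lemma psi_single:
  "psi n \<D> (Poly_Mapping.single \<mu> c) = Poly_Mapping.single (compl_monom n \<D> \<mu>) c"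
  by (simp add: psi_def)

lemma psi_add: "psi n \<D> (f + g) = psi n \<D> f + psi n \<D> g"
proof -
  let ?K = "Poly_Mapping.keys f \<union> Poly_Mapping.keys g"
  have *: "psi n \<D> h = (\<Sum>\<mu>\<in>?K. Poly_Mapping.single (compl_monom n \<D> \<mu>) (Poly_Mapping.lookup h \<mu>))"
    if "Poly_Mapping.keys h \<subseteq> ?K" for h
    unfolding psi_def
    by (rule sum.mono_neutral_left) (use that in \<open>auto simp: in_keys_iff\<close>)
  have "Poly_Mapping.keys (f + g) \<subseteq> ?K"
    by (rule Poly_Mapping.keys_add)
  then show ?thesis
    by (simp add: * lookup_add single_add sum.distrib)
qed

lemma dissection_finite: "dissection n m \<D> \<Longrightarrow> finite \<D>"
proof -
  assume "dissection n m \<D>"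
  then have "\<D> \<subseteq> Pow (vertices n)"
    by (auto simp: dissection_def pieces_def)
  then show "finite \<D>"
    by (rule finite_subset) (simp add: vertices_def)
qed

lemma finite_walks: "finite \<D> \<Longrightarrow> finite (walks n \<D> i j)"
  by (rule finite_subset[OF _ finite_lists_length_eq[of \<D> "steps n i j - 1"]])
     (auto simp: walks_def)

lemma prod_Indet:
  "finite A \<Longrightarrow> (\<Prod>t\<in>A. Indet (h t)) =
     Poly_Mapping.single (\<Sum>t\<in>A. Poly_Mapping.single (h t) 1) 1"
  by (induction A rule: finite_induct) (auto simp: Indet_def mult_single)

lemma walk_weight_monom:
  "walk_weight n i j w = Poly_Mapping.single
     ((\<Sum>t<length w. Poly_Mapping.single (X (w ! t)) 1) +
      (\<Sum>t<steps n i j. Poly_Mapping.single (Q (wrap n (i + t))) 1)) 1"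
  by (simp add: walk_weight_def prod_Indet mult_single)

lemma count_list_sum: "count_list w a = (\<Sum>t<length w. if w ! t = a then 1 else 0)"
  by (induction w rule: rev_induct) (auto simp: nth_append)

lemma wrap_inj:
  assumes "1 \<le> i" "s < n" "t < n" "wrap n (i + s) = wrap n (i + t)"
  shows "s = t"
proof -
  have *: "(i - 1 + s) mod n = (i - 1 + t) mod n"
    using assms by (simp add: wrap_def)
  have "s = t" if "s \<le> t" "t < n" "(i - 1 + s) mod n = (i - 1 + t) mod n" for s t :: nat
  proof -
    have "n dvd (i - 1 + t) - (i - 1 + s)"
      using that by (metis add_le_mono le_refl mod_eq_dvd_iff_nat)
    then have "n dvd t - s" by simp
    then show "s = t" using that by (auto dest: dvd_imp_le)
  qed
  then show ?thesis
    using * assms by (metis nat_le_linear)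
qed

lemma walk_weight_in_Pol:
  assumes "i \<in> {1..n}" "w \<in> walks n \<D> i j"
  shows "walk_weight n i j w \<in> Pol n \<D>"
proof -
  define \<mu> where "\<mu> = (\<Sum>t<length w. Poly_Mapping.single (X (w ! t)) (1::nat)) +
      (\<Sum>t<steps n i j. Poly_Mapping.single (Q (wrap n (i + t))) 1)"
  have n: "n > 0" using assms by auto
  have st: "steps n i j < n" using n by (simp add: steps_def)
  have "Poly_Mapping.keys \<mu> \<subseteq>
     (\<Union>t<length w. Poly_Mapping.keys (Poly_Mapping.single (X (w ! t)) (1::nat))) \<union>
     (\<Union>t<steps n i j. Poly_Mapping.keys (Poly_Mapping.single (Q (wrap n (i + t))) (1::nat)))"
    unfolding \<mu>_def by (rule order_trans[OF Poly_Mapping.keys_add Un_mono[OF keys_sum keys_sum]])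
  also have "\<dots> \<subseteq> X ` \<D> \<union> Q ` {1..n}"
    using assms n by (auto simp: walks_def wrap_def Suc_le_eq subset_iff)
  finally have 1: "Poly_Mapping.keys \<mu> \<subseteq> X ` \<D> \<union> Q ` {1..n}" .
  have "Poly_Mapping.lookup \<mu> (X \<alpha>) = count_list w \<alpha>" for \<alpha>
    by (simp add: \<mu>_def lookup_add lookup_sum lookup_single count_list_sum when_def cong: if_cong)
  then have 2: "\<forall>\<alpha>\<in>\<D>. Poly_Mapping.lookup \<mu> (X \<alpha>) \<le> card \<alpha> - 2"
    using assms by (simp add: walks_def)
  have 3: "Poly_Mapping.lookup \<mu> (Q k) \<le> 1" for k
  proof -
    have "Poly_Mapping.lookup \<mu> (Q k) = (\<Sum>t<steps n i j. if wrap n (i + t) = k then 1 else 0)"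
      by (simp add: \<mu>_def lookup_add lookup_sum lookup_single when_def cong: if_cong)
    also have "\<dots> = card {t \<in> {..<steps n i j}. wrap n (i + t) = k}"
      by (simp add: sum.If_cases Int_def)
    also have "\<dots> \<le> 1"
      using wrap_inj[of i _ n] st assms by (auto simp: card_le_Suc0_iff_eq)
    finally show ?thesis .
  qed
  have "walk_weight n i j w = Poly_Mapping.single \<mu> 1"
    by (simp add: walk_weight_monom \<mu>_def)
  then show ?thesis
    using 1 2 3 by (simp add: Pol_def)
qed

lemma weight_matrix_in_Pol:
  assumes "i \<in> {1..n}"
  shows "weight_matrix n \<D> i j \<in> Pol n \<D>"
proof -
  have "Poly_Mapping.keys (weight_matrix n \<D> i j) \<subseteq>
      (\<Union>w\<in>walks n \<D> i j. Poly_Mapping.keys (walk_weight n i j w))"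
    unfolding weight_matrix_def by (rule keys_sum)
  then show ?thesis
    using walk_weight_in_Pol[OF assms] unfolding Pol_def by blast
qed

end

theory Submission
  imports Defs "HOL-Library.FuncSet"
begin

text \<open>
  The coefficients of \<open>v\<^sub>i\<^sub>j\<close> count the assignments of incident pieces to the vertices strictly
  between \<open>i\<close> and \<open>j\<close> with prescribed multiplicities.  Complementarity of these counts is shown by
  cutting the polygon along a diagonal \<open>{u, w}\<close> into polygons \<open>A\<close> and \<open>B\<close>.  If the diagonal
  separates \<open>i\<close> (in \<open>A\<close>) from \<open>j\<close> (in \<open>B\<close>) and \<open>w\<close> is the endpoint met on the way from \<open>i\<close> to
  \<open>j\<close>, then \<open>w\<close> takes its piece from either polygon, so that
  \<open>v\<^sub>i\<^sub>j = v\<^sup>A\<^sub>i\<^sub>u v\<^sup>B\<^sub>w\<^sub>j + v\<^sup>A\<^sub>i\<^sub>w v\<^sup>B\<^sub>u\<^sub>j\<close> up to edge weights; the formula for \<open>v\<^sub>j\<^sub>i\<close> is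
  termwise complementary.  If \<open>i\<close> and \<open>j\<close> both lie in \<open>A\<close>, one of the two walks avoids \<open>B\<close> and the
  other one exhausts its pieces, since the degrees satisfy \<open>\<Sum> (d - 2) = n - 2\<close>.
\<close>

section \<open>Counting assignments of pieces to vertices\<close>

text \<open>An exponent vector \<open>a\<close> selects a single coefficient, hence exact
  multiplicities. Positions are vertices rather than list indices, so that arcs can be cut and glued
  as sets; extensionality makes each assignment count once.\<close>

definition assignments :: "nat set set \<Rightarrow> nat set \<Rightarrow> (nat set \<Rightarrow> nat) \<Rightarrow> (nat \<Rightarrow> nat set) set" where
  "assignments \<D> S a = {p \<in> S \<rightarrow>\<^sub>E \<D>. (\<forall>v\<in>S. v \<in> p v) \<and> (\<forall>\<alpha>\<in>\<D>. card {v \<in> S. p v = \<alpha>} = a \<alpha>)}"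

definition num_assignments :: "nat set set \<Rightarrow> nat set \<Rightarrow> (nat set \<Rightarrow> nat) \<Rightarrow> nat" where
  "num_assignments \<D> S a = card (assignments \<D> S a)"

lemma assignmentsI:
  assumes "\<And>v. v \<in> S \<Longrightarrow> p v \<in> \<D>" "\<And>v. v \<in> S \<Longrightarrow> v \<in> p v" "p \<in> extensional S"
    and "\<And>\<alpha>. \<alpha> \<in> \<D> \<Longrightarrow> card {v \<in> S. p v = \<alpha>} = a \<alpha>"
  shows "p \<in> assignments \<D> S a"
  using assms by (simp add: assignments_def PiE_iff)

lemma finite_assignments: "finite \<D> \<Longrightarrow> finite S \<Longrightarrow> finite (assignments \<D> S a)"
  by (rule finite_subset[of _ "S \<rightarrow>\<^sub>E \<D>"]) (auto simp: assignments_def intro: finite_PiE)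

lemma num_assignments_cong:
  "(\<And>\<alpha>. \<alpha> \<in> \<D> \<Longrightarrow> a \<alpha> = b \<alpha>) \<Longrightarrow> num_assignments \<D> S a = num_assignments \<D> S b"
  by (simp add: num_assignments_def assignments_def)

lemma num_assignments_eq_0_incidence:
  assumes "\<not> S \<subseteq> \<Union>\<D>"
  shows "num_assignments \<D> S a = 0"
proof -
  have "assignments \<D> S a = {}"
    using assms by (auto simp: assignments_def PiE_def Pi_def)
  then show ?thesis by (simp add: num_assignments_def)
qed

text \<open>The fibres of an assignment partition \<open>S\<close>, which forces
  \<open>card S\<close> to be the sum of the prescribed multiplicities. This rules out most ways of
  distributing vertices over two polygons.\<close>

lemma num_assignments_eq_0_card:
  assumes "finite \<D>" "finite S" "card S \<noteq> sum a \<D>"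
  shows "num_assignments \<D> S a = 0"
proof -
  have False if "p \<in> assignments \<D> S a" for p
  proof -
    have p: "p ` S \<subseteq> \<D>" "\<And>\<alpha>. \<alpha> \<in> \<D> \<Longrightarrow> card {v \<in> S. p v = \<alpha>} = a \<alpha>"
      using that by (auto simp: assignments_def)
    have "card S = (\<Sum>\<alpha>\<in>\<D>. \<Sum>v | v \<in> S \<and> p v = \<alpha>. 1)"
      by (simp only: sum.group[OF assms(2,1) p(1)]) simp
    also have "\<dots> = sum a \<D>"
      by (rule sum.cong) (auto simp: p(2))
    finally show False using assms(3) by simp
  qed
  then have "assignments \<D> S a = {}" by blast
  then show ?thesis by (simp add: num_assignments_def)
qed

text \<open>An assignment amounts to the set \<open>T\<close> of vertices whose piece lies in
  \<open>\<D>\<^sub>1\<close> and its restrictions to \<open>T\<close> and \<open>S - T\<close>,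
  which can be chosen independently. Disjointness of the families lets \<open>T\<close> be recovered
  from the glued function.\<close>

lemma num_assignments_Un:
  assumes "finite S" "finite \<D>\<^sub>1" "finite \<D>\<^sub>2" "\<D>\<^sub>1 \<inter> \<D>\<^sub>2 = {}"
  shows "num_assignments (\<D>\<^sub>1 \<union> \<D>\<^sub>2) S a =
    (\<Sum>T\<in>Pow S. num_assignments \<D>\<^sub>1 T a * num_assignments \<D>\<^sub>2 (S - T) a)"
proof -
  let ?B = "SIGMA T:Pow S. assignments \<D>\<^sub>1 T a \<times> assignments \<D>\<^sub>2 (S - T) a"
  let ?T = "\<lambda>p. {v \<in> S. p v \<in> \<D>\<^sub>1}"
  let ?f = "\<lambda>p. (?T p, restrict p (?T p), restrict p (S - ?T p))"
  let ?g = "\<lambda>(T, p, p'). \<lambda>v. if v \<in> T then p v else p' v :: nat set"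
  have T: "?T (?g (T, p, p')) = T"
    if "T \<subseteq> S" "p \<in> assignments \<D>\<^sub>1 T a" "p' \<in> assignments \<D>\<^sub>2 (S - T) a" for T p p'
    using that assms(4) by (fastforce simp: assignments_def PiE_iff)
  have "bij_betw ?f (assignments (\<D>\<^sub>1 \<union> \<D>\<^sub>2) S a) ?B"
  proof (rule bij_betw_byWitness[where f' = ?g])
    show "\<forall>p\<in>assignments (\<D>\<^sub>1 \<union> \<D>\<^sub>2) S a. ?g (?f p) = p"
      by (auto simp: assignments_def fun_eq_iff PiE_iff extensional_def)
    show "\<forall>x\<in>?B. ?f (?g x) = x"
    proof (clarify, goal_cases)
      case (1 T p p')
      then have "restrict (?g (T, p, p')) T = p" "restrict (?g (T, p, p')) (S - T) = p'"
        by (auto simp: assignments_def fun_eq_iff PiE_iff extensional_def)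
      then show ?case using T[of T p p'] 1 by simp
    qed
    show "?f ` assignments (\<D>\<^sub>1 \<union> \<D>\<^sub>2) S a \<subseteq> ?B"
    proof (clarify, goal_cases)
      case (1 _ _ _ p)
      have *: "{v \<in> ?T p. restrict p (?T p) v = \<alpha>} = {v \<in> S. p v = \<alpha>}" if "\<alpha> \<in> \<D>\<^sub>1" for \<alpha>
        using that by auto
      have **: "{v \<in> S - ?T p. restrict p (S - ?T p) v = \<alpha>} = {v \<in> S. p v = \<alpha>}" if "\<alpha> \<in> \<D>\<^sub>2" for \<alpha>
        using that assms(4) by auto
      have p: "p v \<in> \<D>\<^sub>1 \<union> \<D>\<^sub>2" "v \<in> p v" if "v \<in> S" for v
        using 1 that by (auto simp: assignments_def PiE_iff)
      have p_card: "card {v \<in> S. p v = \<alpha>} = a \<alpha>" if "\<alpha> \<in> \<D>\<^sub>1 \<union> \<D>\<^sub>2" for \<alpha>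
        using 1 that by (auto simp: assignments_def)
      have "restrict p (?T p) \<in> assignments \<D>\<^sub>1 (?T p) a"
        by (rule assignmentsI) (use p p_card in \<open>auto simp only: * Un_iff, auto split: if_splits\<close>)
      moreover have "restrict p (S - ?T p) \<in> assignments \<D>\<^sub>2 (S - ?T p) a"
        by (rule assignmentsI) (use p p_card in \<open>auto simp only: ** Un_iff, auto split: if_splits\<close>)
      ultimately show ?case by auto
    qed
    show "?g ` ?B \<subseteq> assignments (\<D>\<^sub>1 \<union> \<D>\<^sub>2) S a"
    proof (clarify, goal_cases)
      case (1 _ T p p')
      then have p: "p \<in> assignments \<D>\<^sub>1 T a" "p' \<in> assignments \<D>\<^sub>2 (S - T) a" "T \<subseteq> S" by auto
      have "p v \<in> \<D>\<^sub>1 - \<D>\<^sub>2" if "v \<in> T" for v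
        using p(1) that assms(4) by (auto simp: assignments_def PiE_iff)
      moreover have "p' v \<in> \<D>\<^sub>2 - \<D>\<^sub>1" if "v \<in> S" "v \<notin> T" for v
        using p(2) that assms(4) by (auto simp: assignments_def PiE_iff)
      ultimately have "\<alpha> \<in> \<D>\<^sub>1 \<Longrightarrow> {v \<in> S. (if v \<in> T then p v else p' v) = \<alpha>} = {v \<in> T. p v = \<alpha>}"
        "\<alpha> \<in> \<D>\<^sub>2 \<Longrightarrow> {v \<in> S. (if v \<in> T then p v else p' v) = \<alpha>} = {v \<in> S - T. p' v = \<alpha>}" for \<alpha>
        using p(3) by (auto split: if_splits) metis+
      then have "card {v \<in> S. (if v \<in> T then p v else p' v) = \<alpha>} = a \<alpha>" if "\<alpha> \<in> \<D>\<^sub>1 \<union> \<D>\<^sub>2" for \<alpha>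
        using that p(1,2) by (elim UnE) (simp_all add: assignments_def split del: if_split)
      then show ?case
        using p unfolding prod.case
        by (intro assignmentsI) (auto simp: assignments_def PiE_iff extensional_def split del: if_split,
            auto split: if_splits)
    qed
  qed
  then have "num_assignments (\<D>\<^sub>1 \<union> \<D>\<^sub>2) S a = card ?B"
    unfolding num_assignments_def by (rule bij_betw_same_card)
  also have "\<dots> = (\<Sum>T\<in>Pow S. card (assignments \<D>\<^sub>1 T a \<times> assignments \<D>\<^sub>2 (S - T) a))"
    using assms by (intro card_SigmaI ballI)
      (auto intro!: finite_assignments intro: finite_subset)
  finally show ?thesis
    by (simp add: num_assignments_def card_cartesian_product)
qed

lemma num_assignments_singleton:
  assumes "S \<subseteq> \<alpha>"
  shows "num_assignments {\<alpha>} S a = (if card S = a \<alpha> then 1 else 0)"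
proof -
  have "S \<rightarrow>\<^sub>E {\<alpha>} = {\<lambda>v\<in>S. \<alpha>}"
    by (auto simp: PiE_iff extensional_def fun_eq_iff)
  moreover have "{v \<in> S. (\<lambda>v\<in>S. \<alpha>) v = \<alpha>} = S" by auto
  ultimately have "assignments {\<alpha>} S a = (if card S = a \<alpha> then {\<lambda>v\<in>S. \<alpha>} else {})"
    using assms unfolding assignments_def by (auto simp del: restrict_apply)
  then show ?thesis by (simp add: num_assignments_def)
qed


section \<open>Complementary sets of vertices\<close>

text \<open>Coefficientwise form of the identity for \<open>psi\<close>, with the edge weights left
  out. The bound on \<open>a\<close> makes the subtraction exact, so that complementing exponents is
  an involution.\<close>

definition complementary :: "nat set set \<Rightarrow> nat set \<Rightarrow> nat set \<Rightarrow> bool" where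
  "complementary \<D> S S' \<longleftrightarrow> (\<forall>a. (\<forall>\<alpha>\<in>\<D>. a \<alpha> \<le> card \<alpha> - 2) \<longrightarrow>
     num_assignments \<D> S a = num_assignments \<D> S' (\<lambda>\<alpha>. card \<alpha> - 2 - a \<alpha>))"

lemma complementary_sym:
  assumes "complementary \<D> S S'"
  shows "complementary \<D> S' S"
  unfolding complementary_def
proof (intro allI impI)
  fix a :: "nat set \<Rightarrow> nat"
  assume a: "\<forall>\<alpha>\<in>\<D>. a \<alpha> \<le> card \<alpha> - 2"
  have "num_assignments \<D> S (\<lambda>\<alpha>. card \<alpha> - 2 - a \<alpha>) =
      num_assignments \<D> S' (\<lambda>\<alpha>. card \<alpha> - 2 - (card \<alpha> - 2 - a \<alpha>))"
    by (rule assms[unfolded complementary_def, rule_format]) simp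
  also have "\<dots> = num_assignments \<D> S' a"
    using a by (intro num_assignments_cong) auto
  finally show "num_assignments \<D> S' a = num_assignments \<D> S (\<lambda>\<alpha>. card \<alpha> - 2 - a \<alpha>)" by simp
qed

text \<open>What the gluing arguments use of a cut: disjoint families of pieces, each confined to
  the vertices of its own polygon. In the application \<open>V\<^sub>1 \<inter> V\<^sub>2\<close>
  consists of the endpoints of the diagonal.\<close>

locale two_parts =
  fixes \<D>\<^sub>1 \<D>\<^sub>2 :: "nat set set" and V\<^sub>1 V\<^sub>2 :: "nat set"
  assumes fin: "finite \<D>\<^sub>1" "finite \<D>\<^sub>2" "finite V\<^sub>1" "finite V\<^sub>2"
    and disj: "\<D>\<^sub>1 \<inter> \<D>\<^sub>2 = {}"
    and sub: "\<Union>\<D>\<^sub>1 \<subseteq> V\<^sub>1" "\<Union>\<D>\<^sub>2 \<subseteq> V\<^sub>2"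
begin

text \<open>A nonzero term needs pieces incident to all vertices of \<open>T\<close> and
  \<open>S - T\<close>, and as many vertices in \<open>S - T\<close> as \<open>a\<close> prescribes
  for \<open>\<D>\<^sub>2\<close>. The sum over all subsets therefore shrinks to any family
  \<open>\<S>\<close> containing the \<open>T\<close> that pass these tests.\<close>

lemma num_assignments_Un_eq_sum:
  assumes "finite S" "\<S> \<subseteq> Pow S"
    and "\<And>T. T \<subseteq> S \<Longrightarrow> T \<subseteq> V\<^sub>1 \<Longrightarrow> S - T \<subseteq> V\<^sub>2 \<Longrightarrow> card (S - T) = sum a \<D>\<^sub>2 \<Longrightarrow> T \<in> \<S>"
  shows "num_assignments (\<D>\<^sub>1 \<union> \<D>\<^sub>2) S a =
    (\<Sum>T\<in>\<S>. num_assignments \<D>\<^sub>1 T a * num_assignments \<D>\<^sub>2 (S - T) a)"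
proof -
  have "num_assignments \<D>\<^sub>1 T a * num_assignments \<D>\<^sub>2 (S - T) a = 0" if T: "T \<in> Pow S - \<S>" for T
  proof (rule ccontr)
    assume "\<not> ?thesis"
    then have nz: "num_assignments \<D>\<^sub>1 T a \<noteq> 0" "num_assignments \<D>\<^sub>2 (S - T) a \<noteq> 0" by auto
    have "T \<subseteq> \<Union>\<D>\<^sub>1" "S - T \<subseteq> \<Union>\<D>\<^sub>2"
      using nz by (metis num_assignments_eq_0_incidence)+
    moreover have "card (S - T) = sum a \<D>\<^sub>2"
      using nz(2) num_assignments_eq_0_card[of \<D>\<^sub>2 "S - T" a] fin(2) assms(1) by auto
    ultimately have "T \<subseteq> V\<^sub>1" "S - T \<subseteq> V\<^sub>2" "card (S - T) = sum a \<D>\<^sub>2"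
      using sub by blast+
    then show False
      using T assms(3)[of T] by blast
  qed
  then show ?thesis
    unfolding num_assignments_Un[OF assms(1) fin(1,2) disj]
    using assms by (intro sum.mono_neutral_right) auto
qed

text \<open>
  Both ends of the walk lie in the first polygon.  The pieces of the second one have just enough
  capacity for its vertices other than the endpoints of the cutting diagonal, so that no piece
  remains for these endpoints.
\<close>

lemma complementary_same_side:
  assumes "complementary \<D>\<^sub>1 S S'" "complementary \<D>\<^sub>2 {} (V\<^sub>2 - V\<^sub>1)"
    and "S \<subseteq> V\<^sub>1 - V\<^sub>2" "S' \<subseteq> V\<^sub>1"
    and "(\<Sum>\<alpha>\<in>\<D>\<^sub>2. card \<alpha> - 2) = card (V\<^sub>2 - V\<^sub>1)"
  shows "complementary (\<D>\<^sub>1 \<union> \<D>\<^sub>2) S (S' \<union> (V\<^sub>2 - V\<^sub>1))"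
  unfolding complementary_def
proof (intro allI impI)
  fix a :: "nat set \<Rightarrow> nat"
  assume a: "\<forall>\<alpha>\<in>\<D>\<^sub>1 \<union> \<D>\<^sub>2. a \<alpha> \<le> card \<alpha> - 2"
  define b where "b = (\<lambda>\<alpha>. card \<alpha> - 2 - a \<alpha>)"
  let ?S = "S' \<union> (V\<^sub>2 - V\<^sub>1)"
  have finS: "finite S" "finite ?S"
    using assms fin by (auto intro: finite_subset)
  \<comment> \<open>No vertex of \<open>S\<close> lies in \<open>V\<^sub>2\<close>, so the second
    family is left with the empty set; the hypothesis on \<open>{}\<close> then turns this factor
    into a count over \<open>V\<^sub>2 - V\<^sub>1\<close>.\<close>
  have "num_assignments (\<D>\<^sub>1 \<union> \<D>\<^sub>2) S a =
      (\<Sum>T\<in>{S}. num_assignments \<D>\<^sub>1 T a * num_assignments \<D>\<^sub>2 (S - T) a)"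
    using assms finS by (intro num_assignments_Un_eq_sum) auto
  also have "\<dots> = num_assignments \<D>\<^sub>1 S' b * num_assignments \<D>\<^sub>2 (V\<^sub>2 - V\<^sub>1) b"
    using assms(1,2) a by (simp add: complementary_def b_def)
  also have "\<dots> = (\<Sum>T\<in>{S'}. num_assignments \<D>\<^sub>1 T b * num_assignments \<D>\<^sub>2 (?S - T) b)"
    using assms(4) by (simp add: Un_Diff Diff_triv)
      (metis Diff_disjoint Diff_triv Int_Diff inf.absorb_iff2 Int_commute inf_bot_left)
  also have "\<dots> = num_assignments (\<D>\<^sub>1 \<union> \<D>\<^sub>2) ?S b"
  proof (rule num_assignments_Un_eq_sum[symmetric])
    fix T
    assume T: "T \<subseteq> ?S" "T \<subseteq> V\<^sub>1" "?S - T \<subseteq> V\<^sub>2" "card (?S - T) = sum b \<D>\<^sub>2"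
    \<comment> \<open>Since \<open>T\<close> stays inside \<open>V\<^sub>1\<close>, the second
      family must serve all of \<open>V\<^sub>2 - V\<^sub>1\<close>, and its capacity allows nothing
      beyond that.\<close>
    have "V\<^sub>2 - V\<^sub>1 \<subseteq> ?S - T" using T by blast
    moreover have "card (?S - T) \<le> card (V\<^sub>2 - V\<^sub>1)"
      unfolding T(4) assms(5)[symmetric] by (rule sum_mono) (simp add: b_def)
    ultimately have "V\<^sub>2 - V\<^sub>1 = ?S - T"
      using finS by (intro card_seteq) auto
    then show "T \<in> {S'}" using T assms(4) by blast
  qed (use finS in auto)
  finally show "num_assignments (\<D>\<^sub>1 \<union> \<D>\<^sub>2) S a = num_assignments (\<D>\<^sub>1 \<union> \<D>\<^sub>2) ?S b" .
qed

text \<open>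
  The ends of the walk are separated by the cutting diagonal, so the walk passes through exactly
  one endpoint of the diagonal; this vertex takes its piece from either of the two polygons.
\<close>

lemma num_assignments_across:
  assumes "S\<^sub>1 \<subseteq> V\<^sub>1 - V\<^sub>2" "S\<^sub>2 \<subseteq> V\<^sub>2 - V\<^sub>1" "w \<in> V\<^sub>1 \<inter> V\<^sub>2"
  shows "num_assignments (\<D>\<^sub>1 \<union> \<D>\<^sub>2) (insert w (S\<^sub>1 \<union> S\<^sub>2)) a =
    num_assignments \<D>\<^sub>1 (insert w S\<^sub>1) a * num_assignments \<D>\<^sub>2 S\<^sub>2 a +
    num_assignments \<D>\<^sub>1 S\<^sub>1 a * num_assignments \<D>\<^sub>2 (insert w S\<^sub>2) a"
proof -
  have "finite (insert w (S\<^sub>1 \<union> S\<^sub>2))"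
    using assms fin by (auto intro: finite_subset)
  \<comment> \<open>Vertices of \<open>S\<^sub>1\<close> are forced into \<open>T\<close> and those
    of \<open>S\<^sub>2\<close> out of it; only \<open>w\<close> is free.\<close>
  then have "num_assignments (\<D>\<^sub>1 \<union> \<D>\<^sub>2) (insert w (S\<^sub>1 \<union> S\<^sub>2)) a =
      (\<Sum>T\<in>{insert w S\<^sub>1, S\<^sub>1}. num_assignments \<D>\<^sub>1 T a * num_assignments \<D>\<^sub>2 (insert w (S\<^sub>1 \<union> S\<^sub>2) - T) a)"
    using assms by (intro num_assignments_Un_eq_sum) blast+
  moreover have "insert w (S\<^sub>1 \<union> S\<^sub>2) - insert w S\<^sub>1 = S\<^sub>2" "insert w (S\<^sub>1 \<union> S\<^sub>2) - S\<^sub>1 = insert w S\<^sub>2"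
    "insert w S\<^sub>1 \<noteq> S\<^sub>1"
    using assms by blast+
  ultimately show ?thesis by simp
qed

text \<open>Complementing exchanges the two summands: if \<open>w\<close> takes its piece from the
  first polygon, then on the way back \<open>u\<close> takes its piece from the second one, and vice
  versa.\<close>

lemma complementary_across:
  assumes "complementary \<D>\<^sub>1 (insert w S\<^sub>1) S\<^sub>1'" "complementary \<D>\<^sub>1 S\<^sub>1 (insert u S\<^sub>1')"
    and "complementary \<D>\<^sub>2 (insert w S\<^sub>2) S\<^sub>2'" "complementary \<D>\<^sub>2 S\<^sub>2 (insert u S\<^sub>2')"
    and "S\<^sub>1 \<subseteq> V\<^sub>1 - V\<^sub>2" "S\<^sub>2 \<subseteq> V\<^sub>2 - V\<^sub>1" "w \<in> V\<^sub>1 \<inter> V\<^sub>2"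
    and "S\<^sub>1' \<subseteq> V\<^sub>1 - V\<^sub>2" "S\<^sub>2' \<subseteq> V\<^sub>2 - V\<^sub>1" "u \<in> V\<^sub>1 \<inter> V\<^sub>2"
  shows "complementary (\<D>\<^sub>1 \<union> \<D>\<^sub>2) (insert w (S\<^sub>1 \<union> S\<^sub>2)) (insert u (S\<^sub>1' \<union> S\<^sub>2'))"
  using assms(1-4)
  unfolding complementary_def num_assignments_across[OF assms(5-7)] num_assignments_across[OF assms(8-10)]
  by simp

end


section \<open>Cutting along diagonals\<close>

text \<open>The vertices strictly between distinct \<open>i\<close> and \<open>j\<close> in
  counterclockwise order; for \<open>i > j\<close> the arc passes from the largest label to the
  smallest. \<open>V\<close> may be any set of labels, so that polygons cut off keep their
  labels.\<close>

definition arc :: "nat set \<Rightarrow> nat \<Rightarrow> nat \<Rightarrow> nat set" where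
  "arc V i j = (if i < j then {v \<in> V. i < v \<and> v < j} else {v \<in> V. i < v \<or> v < j})"

lemma mem_arc: "v \<in> arc V i j \<longleftrightarrow> v \<in> V \<and> (if i < j then i < v \<and> v < j else i < v \<or> v < j)"
  by (simp add: arc_def)

text \<open>Phrased by a vertex strictly on either side instead of by gaps between labels, because
  the labels of a polygon that has been cut off need not be consecutive.\<close>

definition is_diagonal :: "nat set \<Rightarrow> nat \<times> nat \<Rightarrow> bool" where
  "is_diagonal V = (\<lambda>(u, w). u \<in> V \<and> w \<in> V \<and> u < w \<and> (\<exists>v\<in>V. u < v \<and> v < w) \<and> (\<exists>v\<in>V. v < u \<or> w < v))"

text \<open>Counterpart of \<open>side\<close> without a fixed vertex set; with it,
  \<open>cell\<close> and \<open>pieces_on\<close> extend the notion of pieces to polygons with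
  arbitrary labels, as the recursion over cuts requires.\<close>

definition on_side :: "bool \<Rightarrow> nat \<times> nat \<Rightarrow> nat \<Rightarrow> bool" where
  "on_side b \<delta> v \<longleftrightarrow> (if b then fst \<delta> \<le> v \<and> v \<le> snd \<delta> else v \<le> fst \<delta> \<or> snd \<delta> \<le> v)"

definition cell :: "nat set \<Rightarrow> (nat \<times> nat) set \<Rightarrow> (nat \<times> nat \<Rightarrow> bool) \<Rightarrow> nat set" where
  "cell V \<Delta> s = {v \<in> V. \<forall>\<delta>\<in>\<Delta>. on_side (s \<delta>) \<delta> v}"

definition pieces_on :: "nat set \<Rightarrow> (nat \<times> nat) set \<Rightarrow> nat set set" where
  "pieces_on V \<Delta> = {\<alpha>. 3 \<le> card \<alpha> \<and> (\<exists>s. \<alpha> = cell V \<Delta> s)}"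

text \<open>Dissections as built by successive cuts, which is the form suited to induction. The two
  parts share exactly the endpoints of the cutting diagonal.\<close>

inductive dissected :: "nat set \<Rightarrow> nat set set \<Rightarrow> bool" where
  single: "finite V \<Longrightarrow> 3 \<le> card V \<Longrightarrow> dissected V {V}"
| cut: "dissected V\<^sub>1 \<D>\<^sub>1 \<Longrightarrow> dissected V\<^sub>2 \<D>\<^sub>2 \<Longrightarrow> is_diagonal V (u, w) \<Longrightarrow>
    V\<^sub>1 = {v \<in> V. u \<le> v \<and> v \<le> w} \<Longrightarrow> V\<^sub>2 = {v \<in> V. v \<le> u \<or> w \<le> v} \<Longrightarrow>
    dissected V (\<D>\<^sub>1 \<union> \<D>\<^sub>2)"

section \<open>Properties of recursively cut polygons\<close>

lemma dissected_basic:
  assumes "dissected V \<D>"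
  shows "finite V" "3 \<le> card V" "finite \<D>" "\<Union>\<D> \<subseteq> V" "\<forall>\<alpha>\<in>\<D>. 3 \<le> card \<alpha>"
proof -
  have "finite V \<and> 3 \<le> card V \<and> finite \<D> \<and> \<Union>\<D> \<subseteq> V \<and> (\<forall>\<alpha>\<in>\<D>. 3 \<le> card \<alpha>)"
    using assms
  proof induction
    case (cut V\<^sub>1 \<D>\<^sub>1 V\<^sub>2 \<D>\<^sub>2 V u w)
    have V: "V = V\<^sub>1 \<union> V\<^sub>2" and sub: "V\<^sub>1 \<subseteq> V" "V\<^sub>2 \<subseteq> V" using cut.hyps by auto
    have "finite V" using cut.IH V by (metis finite_Un)
    moreover have "card V\<^sub>1 \<le> card V" using sub \<open>finite V\<close> by (intro card_mono)
    ultimately show ?case using cut.IH sub by auto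
  qed auto
  then show "finite V" "3 \<le> card V" "finite \<D>" "\<Union>\<D> \<subseteq> V" "\<forall>\<alpha>\<in>\<D>. 3 \<le> card \<alpha>" by auto
qed

text \<open>A piece common to both families would be contained in \<open>{u, w}\<close>, but pieces
  have at least three vertices.\<close>

lemma cut_two_parts:
  assumes "dissected V\<^sub>1 \<D>\<^sub>1" "dissected V\<^sub>2 \<D>\<^sub>2" "V\<^sub>1 \<inter> V\<^sub>2 = {u, w}"
  shows "two_parts \<D>\<^sub>1 \<D>\<^sub>2 V\<^sub>1 V\<^sub>2"
proof
  note b = dissected_basic[OF assms(1)] dissected_basic[OF assms(2)]
  show "\<D>\<^sub>1 \<inter> \<D>\<^sub>2 = {}"
  proof (rule equals0I)
    fix \<alpha> assume \<alpha>: "\<alpha> \<in> \<D>\<^sub>1 \<inter> \<D>\<^sub>2"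
    then have "\<alpha> \<subseteq> {u, w}" using b assms(3) by blast
    then have "card \<alpha> \<le> card {u, w}" by (intro card_mono) auto
    also have "\<dots> \<le> 2" by (simp add: card_insert_if)
    finally show False using \<alpha> b by fastforce
  qed
qed (use dissected_basic[OF assms(1)] dissected_basic[OF assms(2)] in auto)

text \<open>A cut counts \<open>u\<close> and \<open>w\<close> twice, so the number of vertices
  minus 2 is additive.\<close>

lemma sum_degrees:
  assumes "dissected V \<D>"
  shows "(\<Sum>\<alpha>\<in>\<D>. card \<alpha> - 2) + 2 = card V"
  using assms
proof induction
  case (cut V\<^sub>1 \<D>\<^sub>1 V\<^sub>2 \<D>\<^sub>2 V u w)
  have V: "V = V\<^sub>1 \<union> V\<^sub>2" "V\<^sub>1 \<inter> V\<^sub>2 = {u, w}" "u < w"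
    using cut by (auto simp: is_diagonal_def)
  interpret two_parts \<D>\<^sub>1 \<D>\<^sub>2 V\<^sub>1 V\<^sub>2 by (rule cut_two_parts[OF cut.hyps(1,2) V(2)])
  have "card V\<^sub>1 + card V\<^sub>2 = card V + card {u, w}"
    unfolding V(1) using card_Un_Int[OF fin(3,4)] V(2) by simp
  then show ?case
    using cut.IH V(3) by (simp add: sum.union_disjoint[OF fin(1,2) disj])
qed simp

text \<open>Induction over the cuts. Because all pairs of distinct vertices are covered, the
  induction hypothesis also applies to the ends of the cutting diagonal, which is a boundary edge of
  each part.\<close>

lemma complementary_arcs:
  assumes "dissected V \<D>" "i \<in> V" "j \<in> V" "i \<noteq> j"
  shows "complementary \<D> (arc V i j) (arc V j i)"
  using assms
proof (induction arbitrary: i j)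
  case (single V)
  have "V = insert i (insert j (arc V i j \<union> arc V j i))"
    using single by (auto simp: arc_def)
  moreover have "arc V i j \<inter> arc V j i = {}" "finite (arc V i j)" "finite (arc V j i)"
    "i \<notin> arc V i j \<union> arc V j i" "j \<notin> arc V i j \<union> arc V j i"
    using single by (auto simp: arc_def)
  \<comment> \<open>Apart from the two ends, the arcs share the d - 2 other vertices of the only
    piece, and each arc admits just one multiplicity, its size.\<close>
  ultimately have *: "card V = card (arc V i j) + card (arc V j i) + 2"
    using \<open>i \<noteq> j\<close> by (metis (no_types, lifting) card_Un_disjoint card_insert_disjoint finite_Un
        finite_insert insert_iff add_2_eq_Suc')
  have "arc V i j \<subseteq> V" "arc V j i \<subseteq> V" by (auto simp: arc_def)
  then show ?case
    using * by (auto simp: complementary_def num_assignments_singleton)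
next
  case (cut V\<^sub>1 \<D>\<^sub>1 V\<^sub>2 \<D>\<^sub>2 V u w)
  note V1 = \<open>V\<^sub>1 = _\<close> and V2 = \<open>V\<^sub>2 = _\<close>
  have uw: "u \<in> V" "w \<in> V" "u < w" using cut.hyps by (auto simp: is_diagonal_def)
  have V: "V\<^sub>1 \<inter> V\<^sub>2 = {u, w}" and V': "V\<^sub>2 \<inter> V\<^sub>1 = {u, w}" using uw V1 V2 by auto
  interpret A: two_parts \<D>\<^sub>1 \<D>\<^sub>2 V\<^sub>1 V\<^sub>2 by (rule cut_two_parts[OF cut.hyps(1,2) V])
  interpret B: two_parts \<D>\<^sub>2 \<D>\<^sub>1 V\<^sub>2 V\<^sub>1 by (rule cut_two_parts[OF cut.hyps(2,1) V'])
  have mem: "u \<in> V\<^sub>1" "w \<in> V\<^sub>1" "u \<in> V\<^sub>2" "w \<in> V\<^sub>2" using V by auto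
  have "card (V\<^sub>1 - V\<^sub>2) = card V\<^sub>1 - 2" "card (V\<^sub>2 - V\<^sub>1) = card V\<^sub>2 - 2"
    using V V' A.fin uw by (simp_all add: card_Diff_subset_Int)
  then have full1: "(\<Sum>\<alpha>\<in>\<D>\<^sub>1. card \<alpha> - 2) = card (V\<^sub>1 - V\<^sub>2)"
    and full2: "(\<Sum>\<alpha>\<in>\<D>\<^sub>2. card \<alpha> - 2) = card (V\<^sub>2 - V\<^sub>1)"
    using sum_degrees[OF cut.hyps(1)] sum_degrees[OF cut.hyps(2)] by simp_all
  have "arc V\<^sub>1 w u = {}" "arc V\<^sub>1 u w = V\<^sub>1 - V\<^sub>2" "arc V\<^sub>2 u w = {}" "arc V\<^sub>2 w u = V\<^sub>2 - V\<^sub>1"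
    using uw V1 V2 by (auto simp: arc_def)
  \<comment> \<open>In each part the walk along the diagonal is empty and the opposite walk visits
    every other vertex.\<close>
  then have edge1: "complementary \<D>\<^sub>1 {} (V\<^sub>1 - V\<^sub>2)" and edge2: "complementary \<D>\<^sub>2 {} (V\<^sub>2 - V\<^sub>1)"
    using cut.IH(1)[of w u] cut.IH(2)[of u w] mem uw by simp_all
  note order_rules = less_trans not_less_iff_gr_or_eq le_less order.asym
  \<comment> \<open>The identities between arcs below unfold to membership and the linear order of
    the labels.\<close>
  note mem_simps = set_eq_iff subset_iff mem_arc V1 V2 insert_iff Un_iff Diff_iff mem_Collect_eq
  have across: "complementary (\<D>\<^sub>1 \<union> \<D>\<^sub>2) (arc V i j) (arc V j i)"
    if i: "i \<in> V\<^sub>1 - V\<^sub>2" and j: "j \<in> V\<^sub>2 - V\<^sub>1" for i j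
  proof -
    have i': "i \<in> V" "u < i" "i < w" and j': "j \<in> V" "j < u \<or> w < j"
      using i j V1 V2 by auto
    \<comment> \<open>The way from \<open>i\<close> to \<open>j\<close> leaves
      \<open>V\<^sub>1\<close> at \<open>w\<close>, and the way back enters it at
      \<open>u\<close>.\<close>
    have arcs1: "arc V i j = insert w (arc V\<^sub>1 i w \<union> arc V\<^sub>2 w j)"
      unfolding mem_simps using uw i' j' by (smt (verit) order_rules)
    have arcs2: "arc V j i = insert u (arc V\<^sub>1 u i \<union> arc V\<^sub>2 j u)"
      unfolding mem_simps using uw i' j' by (smt (verit) order_rules)
    \<comment> \<open>In either part \<open>u\<close> and \<open>w\<close> are neighbours, so moving
      one end of an arc across the diagonal adds a single vertex.\<close>
    have arcs3: "arc V\<^sub>1 i u = insert w (arc V\<^sub>1 i w)"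
      unfolding mem_simps using uw i' j' by (smt (verit) order_rules)
    have arcs4: "arc V\<^sub>1 w i = insert u (arc V\<^sub>1 u i)"
      unfolding mem_simps using uw i' j' by (smt (verit) order_rules)
    have arcs5: "arc V\<^sub>2 u j = insert w (arc V\<^sub>2 w j)"
      unfolding mem_simps using uw i' j' by (smt (verit) order_rules)
    have arcs6: "arc V\<^sub>2 j w = insert u (arc V\<^sub>2 j u)"
      unfolding mem_simps using uw i' j' by (smt (verit) order_rules)
    note arcs = arcs1 arcs2 arcs3 arcs4 arcs5 arcs6
    have sub1: "arc V\<^sub>1 i w \<subseteq> V\<^sub>1 - V\<^sub>2"
      unfolding mem_simps using uw i' j' by (smt (verit) order_rules)
    have sub2: "arc V\<^sub>2 w j \<subseteq> V\<^sub>2 - V\<^sub>1"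
      unfolding mem_simps using uw i' j' by (smt (verit) order_rules)
    have sub3: "arc V\<^sub>1 u i \<subseteq> V\<^sub>1 - V\<^sub>2"
      unfolding mem_simps using uw i' j' by (smt (verit) order_rules)
    have sub4: "arc V\<^sub>2 j u \<subseteq> V\<^sub>2 - V\<^sub>1"
      unfolding mem_simps using uw i' j' by (smt (verit) order_rules)
    have ne: "i \<noteq> u" "i \<noteq> w" "j \<noteq> u" "j \<noteq> w" using i' j' uw by auto
    show ?thesis
      unfolding arcs(1,2)
    proof (rule A.complementary_across)
      show "complementary \<D>\<^sub>1 (insert w (arc V\<^sub>1 i w)) (arc V\<^sub>1 u i)"
        using cut.IH(1)[of i u] i mem ne arcs by simp
      show "complementary \<D>\<^sub>1 (arc V\<^sub>1 i w) (insert u (arc V\<^sub>1 u i))"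
        using cut.IH(1)[of i w] i mem ne arcs by simp
      show "complementary \<D>\<^sub>2 (insert w (arc V\<^sub>2 w j)) (arc V\<^sub>2 j u)"
        using cut.IH(2)[of u j] j mem ne arcs by simp
      show "complementary \<D>\<^sub>2 (arc V\<^sub>2 w j) (insert u (arc V\<^sub>2 j u))"
        using cut.IH(2)[of w j] j mem ne arcs by simp
    qed (use sub1 sub2 sub3 sub4 mem in simp_all)
  qed
  \<comment> \<open>With \<open>u \<le> i < j \<le> w\<close> the walk from \<open>i\<close> to
    \<open>j\<close> meets neither endpoint of the diagonal, while the way back runs through all of
    \<open>V\<^sub>2 - V\<^sub>1\<close>.\<close>
  have same1: "complementary (\<D>\<^sub>1 \<union> \<D>\<^sub>2) (arc V i j) (arc V j i)"
    if ij: "i \<in> V\<^sub>1" "j \<in> V\<^sub>1" "i < j" for i j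
  proof -
    have ij': "i \<in> V" "j \<in> V" "u \<le> i \<and> i < j \<and> j \<le> w" and ne: "i \<noteq> j"
      using ij uw V1 V2 by auto
    have a: "arc V i j = arc V\<^sub>1 i j"
      unfolding mem_simps using uw ij' by (smt (verit) order_rules)
    have b: "arc V j i = arc V\<^sub>1 j i \<union> (V\<^sub>2 - V\<^sub>1)"
      unfolding mem_simps using uw ij' by (smt (verit) order_rules)
    have c: "arc V\<^sub>1 i j \<subseteq> V\<^sub>1 - V\<^sub>2"
      unfolding mem_simps using uw ij' by (smt (verit) order_rules)
    have d: "arc V\<^sub>1 j i \<subseteq> V\<^sub>1"
      by (auto simp: mem_arc)
    show ?thesis
      using A.complementary_same_side[OF cut.IH(1)[OF ij(1,2) ne] edge2 c d full2] a b
      by (simp add: Un_commute)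
  qed
  \<comment> \<open>The condition on the order lists the positions from which the walk from
    \<open>i\<close> to \<open>j\<close> avoids \<open>V\<^sub>1\<close>: before \<open>u\<close>,
    after \<open>w\<close>, or through the largest label.\<close>
  have same2: "complementary (\<D>\<^sub>1 \<union> \<D>\<^sub>2) (arc V i j) (arc V j i)"
    if ij: "i \<in> V\<^sub>2" "j \<in> V\<^sub>2" "i < j \<and> (j \<le> u \<or> w \<le> i) \<or> w \<le> i \<and> j \<le> u" for i j
  proof -
    have ij': "i \<in> V" "j \<in> V" "i < j \<and> (j \<le> u \<or> w \<le> i) \<or> w \<le> i \<and> j \<le> u" and ne: "i \<noteq> j"
      using ij uw V1 V2 by auto
    have a: "arc V i j = arc V\<^sub>2 i j"
      unfolding mem_simps using uw ij' by (smt (verit) order_rules)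
    have b: "arc V j i = arc V\<^sub>2 j i \<union> (V\<^sub>1 - V\<^sub>2)"
      unfolding mem_simps using uw ij' by (smt (verit) order_rules)
    have c: "arc V\<^sub>2 i j \<subseteq> V\<^sub>2 - V\<^sub>1"
      unfolding mem_simps using uw ij' by (smt (verit) order_rules)
    have d: "arc V\<^sub>2 j i \<subseteq> V\<^sub>2"
      by (auto simp: mem_arc)
    show ?thesis
      using B.complementary_same_side[OF cut.IH(2)[OF ij(1,2) ne] edge1 c d full1] a b
      by (simp add: Un_commute)
  qed
  have "(i \<in> V\<^sub>1 \<and> j \<in> V\<^sub>1) \<or> (i \<in> V\<^sub>1 - V\<^sub>2 \<and> j \<in> V\<^sub>2 - V\<^sub>1) \<or> (j \<in> V\<^sub>1 - V\<^sub>2 \<and> i \<in> V\<^sub>2 - V\<^sub>1) \<or> (i \<in> V\<^sub>2 \<and> j \<in> V\<^sub>2)"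
    using cut.prems V1 V2 by auto
  then consider "i \<in> V\<^sub>1" "j \<in> V\<^sub>1" | "i \<in> V\<^sub>1 - V\<^sub>2" "j \<in> V\<^sub>2 - V\<^sub>1" | "j \<in> V\<^sub>1 - V\<^sub>2" "i \<in> V\<^sub>2 - V\<^sub>1" | "i \<in> V\<^sub>2" "j \<in> V\<^sub>2"
    by blast
  then show ?case
  proof cases
    case 1
    then show ?thesis
      using same1[of i j] same1[of j i] complementary_sym \<open>i \<noteq> j\<close> by (meson nat_neq_iff)
  next
    case 2
    then show ?thesis by (rule across)
  next
    case 3
    then show ?thesis by (intro complementary_sym[OF across])
  next
    case 4
    \<comment> \<open>For two vertices of \<open>V\<^sub>2\<close>, one of the two directions avoids
      \<open>V\<^sub>1\<close>; symmetry handles the other one.\<close>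
    then have "(i < j \<and> (j \<le> u \<or> w \<le> i) \<or> w \<le> i \<and> j \<le> u) \<or> (j < i \<and> (i \<le> u \<or> w \<le> j) \<or> w \<le> j \<and> i \<le> u)"
      using V2 \<open>i \<noteq> j\<close> by auto
    then show ?thesis
      using same2[OF 4] complementary_sym[OF same2[OF 4(2,1)]] by blast
  qed
qed

text \<open>Induction on the number of vertices: cut along any diagonal of \<open>\<Delta>\<close>.
  By noncrossing, each remaining diagonal belongs to one part, and the pieces of \<open>V\<close>
  are exactly those of the two parts.\<close>

lemma dissected_pieces_on:
  assumes "finite V" "3 \<le> card V"
    and "\<forall>\<delta>\<in>\<Delta>. is_diagonal V \<delta>" "\<forall>\<delta>\<in>\<Delta>. \<forall>\<epsilon>\<in>\<Delta>. \<not> crosses \<delta> \<epsilon>"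
  shows "dissected V (pieces_on V \<Delta>)"
  using assms
proof (induction "card V" arbitrary: V \<Delta> rule: less_induct)
  case less
  show ?case
  proof (cases "\<Delta> = {}")
    case True
    then have "pieces_on V \<Delta> = {V}"
      using less.prems by (auto simp: pieces_on_def cell_def)
    then show ?thesis using less.prems by (simp add: dissected.single)
  next
    case False
    then obtain u w where uw: "(u, w) \<in> \<Delta>" by auto
    define V\<^sub>1 where "V\<^sub>1 = {v \<in> V. u \<le> v \<and> v \<le> w}"
    define V\<^sub>2 where "V\<^sub>2 = {v \<in> V. v \<le> u \<or> w \<le> v}"
    define \<Delta>\<^sub>1 where "\<Delta>\<^sub>1 = {(c, d) \<in> \<Delta>. (c, d) \<noteq> (u, w) \<and> u \<le> c \<and> d \<le> w}"
    \<comment> \<open>A diagonal outside \<open>[u, w]\<close> lies before \<open>u\<close>, after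
      \<open>w\<close>, or spans \<open>[u, w]\<close>; in the last case its inner side contains
      \<open>V\<^sub>1\<close>.\<close>
    define \<Delta>\<^sub>2 where "\<Delta>\<^sub>2 = {(c, d) \<in> \<Delta>. (c, d) \<noteq> (u, w) \<and> (d \<le> u \<or> w \<le> c \<or> c \<le> u \<and> w \<le> d)}"
    have diag: "is_diagonal V (u, w)" using less.prems uw by blast
    then have uwV: "u \<in> V" "w \<in> V" "u < w" by (auto simp: is_diagonal_def)
    have lt: "c < d" "c \<in> V" "d \<in> V" if "(c, d) \<in> \<Delta>" for c d
      using less.prems(3) that by (auto simp: is_diagonal_def)
    have \<Delta>: "\<Delta> = insert (u, w) (\<Delta>\<^sub>1 \<union> \<Delta>\<^sub>2)"
    proof -
      have "(c, d) \<in> insert (u, w) (\<Delta>\<^sub>1 \<union> \<Delta>\<^sub>2)" if "(c, d) \<in> \<Delta>" for c d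
      proof -
        have "\<not> crosses (c, d) (u, w)" using less.prems(4) uw that by blast
        then show ?thesis using lt[OF that] that uwV by (auto simp: \<Delta>\<^sub>1_def \<Delta>\<^sub>2_def)
      qed
      then show ?thesis using uw by (auto simp: \<Delta>\<^sub>1_def \<Delta>\<^sub>2_def)
    qed
    have d1: "\<forall>\<delta>\<in>\<Delta>\<^sub>1. is_diagonal V\<^sub>1 \<delta>"
    proof (clarify)
      fix c d assume cd: "(c, d) \<in> \<Delta>\<^sub>1"
      then have "is_diagonal V (c, d)" using \<Delta> less.prems(3) by blast
      then show "is_diagonal V\<^sub>1 (c, d)"
        using cd uwV unfolding is_diagonal_def V\<^sub>1_def \<Delta>\<^sub>1_def by fastforce
    qed
    have d2: "\<forall>\<delta>\<in>\<Delta>\<^sub>2. is_diagonal V\<^sub>2 \<delta>"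
    proof (clarify)
      fix c d assume cd: "(c, d) \<in> \<Delta>\<^sub>2"
      then have "is_diagonal V (c, d)" using \<Delta> less.prems(3) by blast
      then obtain x y where xy: "c \<in> V" "d \<in> V" "c < d" "x \<in> V" "c < x" "x < d" "y \<in> V" "y < c \<or> d < y"
        by (auto simp: is_diagonal_def)
      \<comment> \<open>Being different from \<open>(u, w)\<close>, a spanning diagonal is strictly
        longer at one end, which puts \<open>u\<close> or \<open>w\<close> strictly inside
        it.\<close>
      have "d \<le> u \<or> w \<le> c \<or> c \<le> u \<and> w \<le> d \<and> (c < u \<or> w < d)"
        using cd by (auto simp: \<Delta>\<^sub>2_def)
      then consider "d \<le> u" | "w \<le> c" | "c < u" "w \<le> d" | "c \<le> u" "w < d" by blast
      then show "is_diagonal V\<^sub>2 (c, d)"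
      proof cases
        case 1
        then have "x \<in> V\<^sub>2" "w \<in> V\<^sub>2" "d < w" "c \<in> V\<^sub>2" "d \<in> V\<^sub>2" using xy uwV by (auto simp: V\<^sub>2_def)
        then show ?thesis using xy by (auto simp: is_diagonal_def)
      next
        case 2
        then have "x \<in> V\<^sub>2" "u \<in> V\<^sub>2" "u < c" "c \<in> V\<^sub>2" "d \<in> V\<^sub>2" using xy uwV by (auto simp: V\<^sub>2_def)
        then show ?thesis using xy by (auto simp: is_diagonal_def)
      next
        case 3
        then have "y \<in> V\<^sub>2" "u \<in> V\<^sub>2" "u < d" "c \<in> V\<^sub>2" "d \<in> V\<^sub>2" using xy uwV by (auto simp: V\<^sub>2_def)
        then show ?thesis using xy 3 by (auto simp: is_diagonal_def)
      next
        case 4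
        then have "y \<in> V\<^sub>2" "w \<in> V\<^sub>2" "c < w" "c \<in> V\<^sub>2" "d \<in> V\<^sub>2" using xy uwV by (auto simp: V\<^sub>2_def)
        then show ?thesis using xy 4 by (auto simp: is_diagonal_def)
      qed
    qed
    \<comment> \<open>Vertices strictly on either side of the cut: each is missing from one part,
      making that part smaller, and is a third vertex of the other part.\<close>
    obtain x y where xy: "x \<in> V" "u < x" "x < w" "y \<in> V" "y < u \<or> w < y"
      using diag by (auto simp: is_diagonal_def)
    have "y \<notin> V\<^sub>1" "x \<notin> V\<^sub>2" "V\<^sub>1 \<subseteq> V" "V\<^sub>2 \<subseteq> V" using xy by (auto simp: V\<^sub>1_def V\<^sub>2_def)
    then have sub: "V\<^sub>1 \<subset> V" "V\<^sub>2 \<subset> V" using xy(1,4) by blast+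
    have fin: "finite V\<^sub>1" "finite V\<^sub>2" using less.prems by (auto simp: V\<^sub>1_def V\<^sub>2_def)
    have "{u, x, w} \<subseteq> V\<^sub>1" "{u, y, w} \<subseteq> V\<^sub>2" using xy uwV by (auto simp: V\<^sub>1_def V\<^sub>2_def)
    then have "card {u, x, w} \<le> card V\<^sub>1" "card {u, y, w} \<le> card V\<^sub>2"
      using fin by (blast intro: card_mono)+
    moreover have "card {u, x, w} = 3" "card {u, y, w} = 3" using xy uwV by auto
    ultimately have card: "3 \<le> card V\<^sub>1" "3 \<le> card V\<^sub>2" by simp_all
    have D1: "dissected V\<^sub>1 (pieces_on V\<^sub>1 \<Delta>\<^sub>1)"
      using less.prems \<Delta> by (intro less.hyps psubset_card_mono sub fin card d1) auto
    have D2: "dissected V\<^sub>2 (pieces_on V\<^sub>2 \<Delta>\<^sub>2)"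
      using less.prems \<Delta> by (intro less.hyps psubset_card_mono sub fin card d2) auto
    have small: "\<not> 3 \<le> card \<alpha>" if "\<alpha> \<subseteq> {u, w}" for \<alpha>
    proof -
      have "card \<alpha> \<le> card {u, w}" using that by (intro card_mono) auto
      then show ?thesis using uwV by simp
    qed
    txt \<open>
      A diagonal of one polygon does not cut the other one: one of its sides contains the other
      polygon, and the other side meets it at most in \<open>u\<close> and \<open>w\<close>.
    \<close>
    have \<Delta>\<^sub>1: "u \<le> fst \<delta>" "fst \<delta> < snd \<delta>" "snd \<delta> \<le> w" "\<delta> \<noteq> (u, w)" if "\<delta> \<in> \<Delta>\<^sub>1" for \<delta>
      using that lt by (auto simp: \<Delta>\<^sub>1_def)
    have \<Delta>\<^sub>2: "fst \<delta> < snd \<delta>" "\<delta> \<noteq> (u, w)"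
      "snd \<delta> \<le> u \<or> w \<le> fst \<delta> \<or> fst \<delta> \<le> u \<and> w \<le> snd \<delta>" if "\<delta> \<in> \<Delta>\<^sub>2" for \<delta>
      using that lt by (auto simp: \<Delta>\<^sub>2_def)
    \<comment> \<open>The side of a diagonal of \<open>\<Delta>\<^sub>2\<close> containing
      \<open>V\<^sub>1\<close>: the inner one exactly if the diagonal spans \<open>[u, w]\<close>.
      For \<open>\<Delta>\<^sub>1\<close> and \<open>V\<^sub>2\<close> it is always the outer
      one.\<close>
    define t where "t = (\<lambda>\<delta>. fst \<delta> \<le> u \<and> w \<le> snd \<delta>)"
    have t2: "on_side (t \<delta>) \<delta> v" if "v \<in> V\<^sub>1" "\<delta> \<in> \<Delta>\<^sub>2" for v \<delta>
      using that(1) \<Delta>\<^sub>2[OF that(2)] uwV by (auto simp: V\<^sub>1_def on_side_def t_def)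
    have t2': "v \<in> {u, w}" if "v \<in> V\<^sub>1" "\<delta> \<in> \<Delta>\<^sub>2" "on_side b \<delta> v" "b \<noteq> t \<delta>" for v \<delta> b
      using that(1,3,4) \<Delta>\<^sub>2[OF that(2)] uwV by (auto simp: V\<^sub>1_def on_side_def t_def split: if_splits)
    have t1: "on_side False \<delta> v" if "v \<in> V\<^sub>2" "\<delta> \<in> \<Delta>\<^sub>1" for v \<delta>
      using that(1) \<Delta>\<^sub>1[OF that(2)] uwV by (auto simp: V\<^sub>2_def on_side_def)
    have t1': "v \<in> {u, w}" if "v \<in> V\<^sub>2" "\<delta> \<in> \<Delta>\<^sub>1" "on_side True \<delta> v" for v \<delta>
      using that(1,3) \<Delta>\<^sub>1[OF that(2)] uwV by (auto simp: V\<^sub>2_def on_side_def)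
    have disj: "\<delta> \<notin> \<Delta>\<^sub>2" if "\<delta> \<in> \<Delta>\<^sub>1" for \<delta>
      using \<Delta>\<^sub>1[OF that] \<Delta>\<^sub>2[of \<delta>] by (cases \<delta>) auto
    have cell: "v \<in> cell V \<Delta> s \<longleftrightarrow> v \<in> (if s (u, w) then V\<^sub>1 else V\<^sub>2) \<and>
        (\<forall>\<delta>\<in>\<Delta>\<^sub>1. on_side (s \<delta>) \<delta> v) \<and> (\<forall>\<delta>\<in>\<Delta>\<^sub>2. on_side (s \<delta>) \<delta> v)" for v s
    proof -
      have "v \<in> (if s (u, w) then V\<^sub>1 else V\<^sub>2) \<longleftrightarrow> v \<in> V \<and> on_side (s (u, w)) (u, w) v"
        by (simp add: V\<^sub>1_def V\<^sub>2_def on_side_def)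
      then show ?thesis unfolding cell_def \<Delta> by blast
    qed
    have "pieces_on V \<Delta> \<subseteq> pieces_on V\<^sub>1 \<Delta>\<^sub>1 \<union> pieces_on V\<^sub>2 \<Delta>\<^sub>2"
    proof
      fix \<alpha> assume "\<alpha> \<in> pieces_on V \<Delta>"
      then obtain s where \<alpha>: "3 \<le> card \<alpha>" "\<alpha> = cell V \<Delta> s" unfolding pieces_on_def by blast
      have "\<not> \<alpha> \<subseteq> {u, w}" using small \<alpha>(1) by blast
      \<comment> \<open>Such a vertex forces the choice of side at every diagonal of the other
        part.\<close>
      then obtain v where v: "v \<in> cell V \<Delta> s" "v \<notin> {u, w}" unfolding \<alpha>(2) by blast
      show "\<alpha> \<in> pieces_on V\<^sub>1 \<Delta>\<^sub>1 \<union> pieces_on V\<^sub>2 \<Delta>\<^sub>2"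
      proof (cases "s (u, w)")
        case True
        have "s \<delta> = t \<delta>" if "\<delta> \<in> \<Delta>\<^sub>2" for \<delta>
          using t2'[OF _ that] v that True unfolding cell by (metis (full_types))
        then have "cell V \<Delta> s = cell V\<^sub>1 \<Delta>\<^sub>1 s"
          using t2 True by (intro set_eqI) (simp add: cell cell_def[of V\<^sub>1] cong: conj_cong)
        then show ?thesis using \<alpha> unfolding pieces_on_def by blast
      next
        case False
        have "\<not> s \<delta>" if "\<delta> \<in> \<Delta>\<^sub>1" for \<delta>
          using t1'[OF _ that] v that False unfolding cell by (metis (full_types))
        then have "cell V \<Delta> s = cell V\<^sub>2 \<Delta>\<^sub>2 s"
          using t1 False by (intro set_eqI) (simp add: cell cell_def[of V\<^sub>2] cong: conj_cong)
        then show ?thesis using \<alpha> unfolding pieces_on_def by blast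
      qed
    qed
    moreover have "pieces_on V\<^sub>1 \<Delta>\<^sub>1 \<subseteq> pieces_on V \<Delta>"
    proof
      fix \<alpha> assume "\<alpha> \<in> pieces_on V\<^sub>1 \<Delta>\<^sub>1"
      then obtain s where \<alpha>: "3 \<le> card \<alpha>" "\<alpha> = cell V\<^sub>1 \<Delta>\<^sub>1 s" unfolding pieces_on_def by blast
      \<comment> \<open>The choice \<open>s\<close> is extended by the sides containing
        \<open>V\<^sub>1\<close>; since \<open>t (u, w)\<close> holds, it also selects
        \<open>V\<^sub>1\<close> at the cut itself.\<close>
      define r where "r = (\<lambda>\<delta>. if \<delta> \<in> \<Delta>\<^sub>1 then s \<delta> else t \<delta>)"
      have "r \<delta> = s \<delta>" if "\<delta> \<in> \<Delta>\<^sub>1" for \<delta> using that by (simp add: r_def)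
      moreover have "r \<delta> = t \<delta>" if "\<delta> \<in> \<Delta>\<^sub>2" for \<delta> using that disj[of \<delta>] by (auto simp: r_def)
      moreover have "r (u, w)" using \<Delta>\<^sub>1(4)[of "(u, w)"] by (auto simp: r_def t_def)
      ultimately have "cell V \<Delta> r = cell V\<^sub>1 \<Delta>\<^sub>1 s"
        using t2 by (intro set_eqI) (simp add: cell cell_def[of V\<^sub>1] cong: conj_cong)
      then show "\<alpha> \<in> pieces_on V \<Delta>" using \<alpha> unfolding pieces_on_def by blast
    qed
    moreover have "pieces_on V\<^sub>2 \<Delta>\<^sub>2 \<subseteq> pieces_on V \<Delta>"
    proof
      fix \<alpha> assume "\<alpha> \<in> pieces_on V\<^sub>2 \<Delta>\<^sub>2"
      then obtain s where \<alpha>: "3 \<le> card \<alpha>" "\<alpha> = cell V\<^sub>2 \<Delta>\<^sub>2 s" unfolding pieces_on_def by blast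
      \<comment> \<open>The value \<open>False\<close> outside \<open>\<Delta>\<^sub>2\<close>
        selects \<open>V\<^sub>2\<close> at the cut and the side containing \<open>V\<^sub>2\<close>
        at each diagonal of \<open>\<Delta>\<^sub>1\<close>.\<close>
      define r where "r = (\<lambda>\<delta>. \<delta> \<in> \<Delta>\<^sub>2 \<and> s \<delta>)"
      have "r \<delta> = s \<delta>" if "\<delta> \<in> \<Delta>\<^sub>2" for \<delta> using that by (simp add: r_def)
      moreover have "\<not> r \<delta>" if "\<delta> \<in> \<Delta>\<^sub>1" for \<delta> using that disj[of \<delta>] by (auto simp: r_def)
      moreover have "\<not> r (u, w)" using \<Delta>\<^sub>2(2)[of "(u, w)"] by (auto simp: r_def)
      ultimately have "cell V \<Delta> r = cell V\<^sub>2 \<Delta>\<^sub>2 s"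
        using t1 by (intro set_eqI) (simp add: cell cell_def[of V\<^sub>2] cong: conj_cong)
      then show "\<alpha> \<in> pieces_on V \<Delta>" using \<alpha> unfolding pieces_on_def by blast
    qed
    ultimately have "pieces_on V \<Delta> = pieces_on V\<^sub>1 \<Delta>\<^sub>1 \<union> pieces_on V\<^sub>2 \<Delta>\<^sub>2" by blast
    then show ?thesis
      using dissected.cut[OF D1 D2 diag V\<^sub>1_def V\<^sub>2_def] by simp
  qed
qed

lemma dissection_dissected:
  assumes "3 \<le> n" "dissection n m \<D>"
  shows "dissected {1..n} \<D>"
proof -
  obtain \<Delta> where \<Delta>: "noncrossing_diagonals n \<Delta>" "\<D> = pieces n \<Delta>"
    using assms by (auto simp: dissection_def)
  have "is_diagonal {1..n} (a, b)" if "(a, b) \<in> \<Delta>" for a b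
  proof -
    \<comment> \<open>Excluding \<open>(1, n)\<close> leaves 1 or \<open>n\<close> as a vertex
      outside, while \<open>a + 1\<close> lies strictly inside.\<close>
    have ab: "1 \<le> a" "b \<le> n" "a + 1 < b" "1 < a \<or> b < n"
      using \<Delta>(1) that by (auto simp: noncrossing_diagonals_def diagonals_def vertices_def)
    then have "\<exists>v\<in>{1..n}. v < a \<or> b < v"
      by (metis atLeastAtMost_iff le_refl less_imp_le le_trans assms(1) One_nat_def
          numeral_3_eq_3 Suc_le_mono le0)
    moreover have "a + 1 \<in> {1..n}" "a < a + 1" using ab by auto
    ultimately show ?thesis using ab unfolding is_diagonal_def by fastforce
  qed
  then have "dissected {1..n} (pieces_on {1..n} \<Delta>)"
    using assms \<Delta> by (intro dissected_pieces_on) (auto simp: noncrossing_diagonals_def)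
  moreover have "pieces_on {1..n} \<Delta> = pieces n \<Delta>"
  proof -
    have "v \<in> side n \<delta> b \<longleftrightarrow> v \<in> vertices n \<and> on_side b \<delta> v" for v \<delta> b
      by (cases \<delta>; cases b) (auto simp: on_side_def)
    then show ?thesis
      by (simp add: pieces_def pieces_on_def cell_def vertices_def cong: conj_cong)
  qed
  ultimately show ?thesis using \<Delta> by simp
qed


section \<open>From assignments to walks\<close>

lemma steps_eq:
  assumes "i \<in> {1..n}" "j \<in> {1..n}"
  shows "steps n i j = (if i \<le> j then j - i else j + n - i)"
proof (cases "i \<le> j")
  case True
  then have "j + n - i = (j - i) + n" "j - i < n" using assms by auto
  then show ?thesis using True unfolding steps_def by (metis mod_add_self2 mod_less)
next
  case False
  then have "j + n - i < n" using assms by auto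
  then show ?thesis using False by (simp add: steps_def)
qed

lemma wrap_eq:
  assumes "i \<in> {1..n}" "s \<le> n"
  shows "wrap n (i + s) = (if i + s \<le> n then i + s else i + s - n)"
proof (cases "i + s \<le> n")
  case False
  then have "i + s - 1 = (i + s - n - 1) + n" "i + s - n - 1 < n" "i + s - n \<ge> 1" using assms by auto
  then have "(i + s - 1) mod n = i + s - n - 1" by (metis mod_add_self2 mod_less)
  then show ?thesis using False \<open>i + s - n \<ge> 1\<close> by (simp add: wrap_def)
next
  case True
  then have "i + s - 1 < n" using assms by auto
  then show ?thesis using True assms by (simp add: wrap_def)
qed

text \<open>The first enumeration lists the vertices that receive pieces, the second one the
  traversed edges. An edge is named after its initial vertex, so the edges include \<open>i\<close>
  besides the arc.\<close>

lemma wrap_arc: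
  assumes "i \<in> {1..n}" "j \<in> {1..n}" "i \<noteq> j"
  shows "bij_betw (\<lambda>t. wrap n (i + 1 + t)) {..<steps n i j - 1} (arc {1..n} i j)"
    and "bij_betw (\<lambda>t. wrap n (i + t)) {..<steps n i j} (insert i (arc {1..n} i j))"
proof -
  have steps: "steps n i j = (if i < j then j - i else j + n - i)" "steps n i j < n"
    using assms steps_eq[OF assms(1,2)] by (auto split: if_splits)
  have inj: "inj_on (\<lambda>t. wrap n (i + t)) {..<n}"
    using assms wrap_inj[of i _ n] by (auto intro!: inj_onI)
  have wrap: "wrap n (i + t) = (if i + t \<le> n then i + t else i + t - n)" if "t < steps n i j" for t
    using wrap_eq[OF assms(1)] that steps(2) by simp
  have arc: "(\<lambda>t. wrap n (i + t)) ` {1..<steps n i j} = arc {1..n} i j"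
  proof
    show "(\<lambda>t. wrap n (i + t)) ` {1..<steps n i j} \<subseteq> arc {1..n} i j"
      using assms steps wrap by (auto simp: arc_def split: if_splits)
    show "arc {1..n} i j \<subseteq> (\<lambda>t. wrap n (i + t)) ` {1..<steps n i j}"
    proof
      fix v assume v: "v \<in> arc {1..n} i j"
      define t where "t = (if i < v then v - i else v + n - i)"
      have "t \<in> {1..<steps n i j}" "v = wrap n (i + t)"
        using v assms steps wrap[of t] by (auto simp: arc_def t_def split: if_splits)
      then show "v \<in> (\<lambda>t. wrap n (i + t)) ` {1..<steps n i j}" by blast
    qed
  qed
  have "{..<steps n i j} = insert 0 {1..<steps n i j}"
    using assms steps by (auto split: if_splits)
  moreover have "wrap n (i + 0) = i" using wrap_eq[OF assms(1), of 0] assms by simp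
  ultimately have "(\<lambda>t. wrap n (i + t)) ` {..<steps n i j} = insert i (arc {1..n} i j)"
    using arc by simp
  then show "bij_betw (\<lambda>t. wrap n (i + t)) {..<steps n i j} (insert i (arc {1..n} i j))"
    using inj steps(2) by (auto simp: bij_betw_def intro: inj_on_subset)
  have "(\<lambda>t. wrap n (i + 1 + t)) = (\<lambda>t. wrap n (i + t)) \<circ> Suc" by auto
  moreover have "bij_betw Suc {..<steps n i j - 1} {1..<steps n i j}"
    unfolding bij_betw_def lessThan_atLeast0 image_Suc_atLeastLessThan
    using assms steps by (auto split: if_splits)
  moreover have "bij_betw (\<lambda>t. wrap n (i + t)) {1..<steps n i j} (arc {1..n} i j)"
    using inj steps(2) arc by (auto simp: bij_betw_def intro: inj_on_subset)
  ultimately show "bij_betw (\<lambda>t. wrap n (i + 1 + t)) {..<steps n i j - 1} (arc {1..n} i j)"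
    using bij_betw_trans by metis
qed

section \<open>Lists of pieces along an arc\<close>

lemma count_list_card: "count_list w \<alpha> = card {t. t < length w \<and> w ! t = \<alpha>}"
  by (simp add: count_list_eq_length_filter length_filter_conv_card eq_commute)

text \<open>The enumeration \<open>g\<close> translates positions into vertices: a list corresponds
  to the function taking \<open>v\<close> to its entry at the position of \<open>v\<close>.\<close>

lemma card_lists_assignments:
  assumes g: "bij_betw g {..<l} S"
  shows "card {w. length w = l \<and> set w \<subseteq> \<D> \<and> (\<forall>t<length w. g t \<in> w ! t) \<and>
    (\<forall>\<alpha>\<in>\<D>. count_list w \<alpha> = a \<alpha>)} = num_assignments \<D> S a" (is "card ?W = _")
proof -
  let ?h = "inv_into {..<l} g"
  have gS: "g t \<in> S" if "t < l" for t using g that by (auto simp: bij_betw_def)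
  have hg: "?h (g t) = t" if "t < l" for t using g that by (simp add: bij_betw_inv_into_left)
  have gh: "g (?h v) = v" "?h v < l" if "v \<in> S" for v
    using g that bij_betw_inv_into_right[OF g that] bij_betw_inv_into[OF g]
    by (auto simp: bij_betw_def)
  have card: "card {t. t < l \<and> P (g t)} = card {v \<in> S. P v}" for P
  proof (rule bij_betw_same_card[of g])
    show "bij_betw g {t. t < l \<and> P (g t)} {v \<in> S. P v}"
      using g gh gS by (auto simp: bij_betw_def inj_on_def image_iff)
  qed
  have "bij_betw (\<lambda>w. \<lambda>v\<in>S. w ! ?h v) ?W (assignments \<D> S a)"
  proof (rule bij_betw_byWitness[where f' = "\<lambda>p. map (p \<circ> g) [0..<l]"])
    show "\<forall>w\<in>?W. map ((\<lambda>v\<in>S. w ! ?h v) \<circ> g) [0..<l] = w"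
      using gS hg by (auto intro!: nth_equalityI)
    show "\<forall>p\<in>assignments \<D> S a. (\<lambda>v\<in>S. map (p \<circ> g) [0..<l] ! ?h v) = p"
      using gh by (auto simp: assignments_def PiE_iff extensional_def fun_eq_iff)
    show "(\<lambda>w. \<lambda>v\<in>S. w ! ?h v) ` ?W \<subseteq> assignments \<D> S a"
    proof clarify
      fix w assume w: "set w \<subseteq> \<D>" "\<forall>t<length w. g t \<in> w ! t" "\<forall>\<alpha>\<in>\<D>. count_list w \<alpha> = a \<alpha>"
        and l: "l = length w"
      show "(\<lambda>v\<in>S. w ! inv_into {..<length w} g v) \<in> assignments \<D> S a"
        unfolding l[symmetric]
      proof (rule assignmentsI)
        fix \<alpha> assume \<alpha>: "\<alpha> \<in> \<D>"
        have "card {v \<in> S. (\<lambda>v\<in>S. w ! ?h v) v = \<alpha>} = card {v \<in> S. w ! ?h v = \<alpha>}"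
          by (rule arg_cong[where f = card]) auto
        also have "\<dots> = card {t. t < l \<and> w ! ?h (g t) = \<alpha>}"
          by (rule card[symmetric])
        also have "\<dots> = card {t. t < l \<and> w ! t = \<alpha>}"
          by (rule arg_cong[where f = card]) (auto simp: hg)
        finally show "card {v \<in> S. (\<lambda>v\<in>S. w ! ?h v) v = \<alpha>} = a \<alpha>"
          using w(3) \<alpha> by (simp add: count_list_card l)
      next
        fix v assume v: "v \<in> S"
        have "w ! ?h v \<in> set w" "g (?h v) \<in> w ! ?h v"
          using w(2)[rule_format, of "?h v"] gh(2)[OF v] l by simp_all
        then show "(\<lambda>v\<in>S. w ! ?h v) v \<in> \<D>" "v \<in> (\<lambda>v\<in>S. w ! ?h v) v"
          using v w gh by auto
      qed simp
    qed
    show "(\<lambda>p. map (p \<circ> g) [0..<l]) ` assignments \<D> S a \<subseteq> ?W"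
    proof clarify
      fix p assume "p \<in> assignments \<D> S a"
      then have p: "\<And>v. v \<in> S \<Longrightarrow> p v \<in> \<D>" "\<And>v. v \<in> S \<Longrightarrow> v \<in> p v"
        "\<And>\<alpha>. \<alpha> \<in> \<D> \<Longrightarrow> card {v \<in> S. p v = \<alpha>} = a \<alpha>"
        by (auto simp: assignments_def PiE_iff)
      have "count_list (map (p \<circ> g) [0..<l]) \<alpha> = card {v \<in> S. p v = \<alpha>}" for \<alpha>
        unfolding count_list_card card[symmetric] by (rule arg_cong[where f = card]) auto
      then show "length (map (p \<circ> g) [0..<l]) = l \<and> set (map (p \<circ> g) [0..<l]) \<subseteq> \<D> \<and>
        (\<forall>t<length (map (p \<circ> g) [0..<l]). g t \<in> map (p \<circ> g) [0..<l] ! t) \<and>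
        (\<forall>\<alpha>\<in>\<D>. count_list (map (p \<circ> g) [0..<l]) \<alpha> = a \<alpha>)"
        using p gS by auto
    qed
  qed
  then show ?thesis unfolding num_assignments_def by (rule bij_betw_same_card)
qed

section \<open>Expansion of matrix entries by exponent vectors\<close>

definition exponents :: "nat set set \<Rightarrow> (nat set \<Rightarrow> nat) set" where
  "exponents \<D> = (\<Pi>\<^sub>E \<alpha>\<in>\<D>. {..card \<alpha> - 2})"

definition monom_of :: "nat set set \<Rightarrow> (nat set \<Rightarrow> nat) \<Rightarrow> nat set \<Rightarrow> monom" where
  "monom_of \<D> a E = (\<Sum>\<alpha>\<in>\<D>. Poly_Mapping.single (X \<alpha>) (a \<alpha>)) + (\<Sum>k\<in>E. Poly_Mapping.single (Q k) 1)"

lemma lookup_monom_of: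
  assumes "finite \<D>" "finite E"
  shows "Poly_Mapping.lookup (monom_of \<D> a E) (X \<alpha>) = (if \<alpha> \<in> \<D> then a \<alpha> else 0)"
    and "Poly_Mapping.lookup (monom_of \<D> a E) (Q k) = (if k \<in> E then 1 else 0)"
  using assms by (simp_all add: monom_of_def lookup_add lookup_sum lookup_single when_def sum.delta)

text \<open>For \<open>k \<in> E\<close> the complementary exponent of \<open>Q k\<close> is 0, so
  only the edges outside \<open>E\<close> survive.\<close>

lemma compl_monom_monom_of:
  assumes "finite \<D>" "E \<subseteq> {1..n}"
  shows "compl_monom n \<D> (monom_of \<D> a E) = monom_of \<D> (\<lambda>\<alpha>. card \<alpha> - 2 - a \<alpha>) ({1..n} - E)"
proof -
  have "finite E" using assms(2) finite_subset by blast
  then have "(\<Sum>k\<in>{1..n}. Poly_Mapping.single (Q k) (1 - Poly_Mapping.lookup (monom_of \<D> a E) (Q k))) =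
      (\<Sum>k\<in>{1..n} - E. Poly_Mapping.single (Q k) (1::nat))"
    by (intro sum.mono_neutral_cong_right) (auto simp: lookup_monom_of[OF assms(1)])
  moreover have "(\<Sum>\<alpha>\<in>\<D>. Poly_Mapping.single (X \<alpha>) (card \<alpha> - 2 - Poly_Mapping.lookup (monom_of \<D> a E) (X \<alpha>))) =
      (\<Sum>\<alpha>\<in>\<D>. Poly_Mapping.single (X \<alpha>) (card \<alpha> - 2 - a \<alpha>))"
    using \<open>finite E\<close> by (intro sum.cong) (simp_all add: lookup_monom_of[OF assms(1)])
  ultimately show ?thesis
    unfolding compl_monom_def monom_of_def[of _ _ "{1..n} - E"] by (rule arg_cong2[where f = "(+)", rotated])
qed

lemma psi_sum: "psi n \<D> (\<Sum>x\<in>A. f x) = (\<Sum>x\<in>A. psi n \<D> (f x))"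
proof -
  have "psi n \<D> 0 = 0" by (simp add: psi_def)
  then show ?thesis by (induction A rule: infinite_finite_induct) (simp_all add: psi_add)
qed

lemma walk_weight_eq:
  assumes "finite \<D>" "w \<in> walks n \<D> i j" "i \<in> {1..n}" "j \<in> {1..n}" "i \<noteq> j"
  shows "walk_weight n i j w =
    Poly_Mapping.single (monom_of \<D> (count_list w) (insert i (arc {1..n} i j))) 1"
proof -
  have "(\<Sum>t<length w. Poly_Mapping.single (X (w ! t)) (1::nat)) =
      (\<Sum>\<alpha>\<in>\<D>. \<Sum>t | t \<in> {..<length w} \<and> w ! t = \<alpha>. Poly_Mapping.single (X (w ! t)) 1)"
    using assms(1,2) by (intro sum.group[symmetric]) (auto simp: walks_def)
  also have "\<dots> = (\<Sum>\<alpha>\<in>\<D>. Poly_Mapping.single (X \<alpha>) (count_list w \<alpha>))"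
  proof (rule sum.cong[OF refl])
    fix \<alpha>
    have "(\<Sum>t | t \<in> {..<length w} \<and> w ! t = \<alpha>. Poly_Mapping.single (X (w ! t)) (1::nat)) =
        (\<Sum>t | t \<in> {..<length w} \<and> w ! t = \<alpha>. Poly_Mapping.single (X \<alpha>) 1)"
      by (rule sum.cong) auto
    also have "\<dots> = Poly_Mapping.single (X \<alpha>) (count_list w \<alpha>)"
      by (rule poly_mapping_eqI)
        (simp add: lookup_sum lookup_single when_def count_list_card)
    finally show "(\<Sum>t | t \<in> {..<length w} \<and> w ! t = \<alpha>. Poly_Mapping.single (X (w ! t)) (1::nat)) =
        Poly_Mapping.single (X \<alpha>) (count_list w \<alpha>)" .
  qed
  finally have "(\<Sum>t<length w. Poly_Mapping.single (X (w ! t)) (1::nat)) =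
      (\<Sum>\<alpha>\<in>\<D>. Poly_Mapping.single (X \<alpha>) (count_list w \<alpha>))" .
  moreover have "(\<Sum>t<steps n i j. Poly_Mapping.single (Q (wrap n (i + t))) (1::nat)) =
      (\<Sum>k\<in>insert i (arc {1..n} i j). Poly_Mapping.single (Q k) 1)"
    by (rule sum.reindex_bij_betw[OF wrap_arc(2)[OF assms(3-5)]])
  ultimately show ?thesis unfolding walk_weight_monom monom_of_def by simp
qed

text \<open>Walks are grouped by multiplicity vector; the degree condition on walks says precisely
  that this vector lies in \<open>exponents \<D>\<close>.\<close>

lemma weight_matrix_eq:
  assumes "finite \<D>" "i \<in> {1..n}" "j \<in> {1..n}" "i \<noteq> j"
  shows "weight_matrix n \<D> i j = (\<Sum>a\<in>exponents \<D>. Poly_Mapping.single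
    (monom_of \<D> a (insert i (arc {1..n} i j))) (int (num_assignments \<D> (arc {1..n} i j) a)))"
proof -
  let ?E = "insert i (arc {1..n} i j)"
  let ?c = "\<lambda>w. restrict (count_list w) \<D>"
  have fin: "finite (exponents \<D>)" using assms(1) by (auto simp: exponents_def intro: finite_PiE)
  \<comment> \<open>Distinct ends make the truncated subtraction \<open>steps n i j - 1\<close>
    exact.\<close>
  have "steps n i j > 0" using assms by (auto simp: steps_eq)
  then have len: "length w + 1 = steps n i j \<longleftrightarrow> length w = steps n i j - 1" for w :: "nat set list"
    by auto
  have card: "card {w \<in> walks n \<D> i j. ?c w = a} = num_assignments \<D> (arc {1..n} i j) a"
    if a: "a \<in> exponents \<D>" for a
  proof -
    have "?c w = a \<longleftrightarrow> (\<forall>\<alpha>\<in>\<D>. count_list w \<alpha> = a \<alpha>)" for w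
      using a by (auto simp: exponents_def PiE_iff extensional_def fun_eq_iff restrict_def)
    moreover have "a \<alpha> \<le> card \<alpha> - 2" if "\<alpha> \<in> \<D>" for \<alpha>
      using a that by (auto simp: exponents_def)
    ultimately have "{w \<in> walks n \<D> i j. ?c w = a} = {w. length w = steps n i j - 1 \<and> set w \<subseteq> \<D> \<and>
        (\<forall>t<length w. wrap n (i + 1 + t) \<in> w ! t) \<and> (\<forall>\<alpha>\<in>\<D>. count_list w \<alpha> = a \<alpha>)}"
      unfolding walks_def len by auto
    then show ?thesis
      using card_lists_assignments[OF wrap_arc(1)[OF assms(2-4)]] by simp
  qed
  have "weight_matrix n \<D> i j = (\<Sum>w\<in>walks n \<D> i j. Poly_Mapping.single (monom_of \<D> (?c w) ?E) 1)"
    unfolding weight_matrix_def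
    using walk_weight_eq[OF assms(1) _ assms(2-4)] by (intro sum.cong) (auto simp: monom_of_def)
  also have "\<dots> = (\<Sum>a\<in>exponents \<D>. \<Sum>w | w \<in> walks n \<D> i j \<and> ?c w = a.
      Poly_Mapping.single (monom_of \<D> (?c w) ?E) 1)"
    by (rule sum.group[symmetric, OF finite_walks[OF assms(1)] fin])
      (auto simp: walks_def exponents_def)
  also have "\<dots> = (\<Sum>a\<in>exponents \<D>. Poly_Mapping.single (monom_of \<D> a ?E)
      (int (num_assignments \<D> (arc {1..n} i j) a)))"
  proof (rule sum.cong[OF refl])
    fix a assume a: "a \<in> exponents \<D>"
    have "(\<Sum>w | w \<in> walks n \<D> i j \<and> ?c w = a. Poly_Mapping.single (monom_of \<D> (?c w) ?E) 1) =
        (\<Sum>w | w \<in> walks n \<D> i j \<and> ?c w = a. Poly_Mapping.single (monom_of \<D> a ?E) (1::int))"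
      by (rule sum.cong) auto
    also have "\<dots> = Poly_Mapping.single (monom_of \<D> a ?E) (int (num_assignments \<D> (arc {1..n} i j) a))"
      by (rule poly_mapping_eqI) (simp only: lookup_sum, simp add: lookup_single when_def card[OF a])
    finally show "(\<Sum>w | w \<in> walks n \<D> i j \<and> ?c w = a. Poly_Mapping.single (monom_of \<D> (?c w) ?E) 1) =
        Poly_Mapping.single (monom_of \<D> a ?E) (int (num_assignments \<D> (arc {1..n} i j) a))" .
  qed
  finally show ?thesis .
qed

theorem corollary4p3:
  fixes n m :: nat and \<D> :: "nat set set"
  assumes "n \<ge> 3"
    and "dissection n m \<D>"
  shows "\<forall>i\<in>{1..n}. \<forall>j\<in>{1..n}.
    weight_matrix n \<D> j i = psi n \<D> (weight_matrix n \<D> i j)"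
proof (intro ballI)
  fix i j assume ij: "i \<in> {1..n}" "j \<in> {1..n}"
  have fin: "finite \<D>" using assms(2) by (rule dissection_finite)
  show "weight_matrix n \<D> j i = psi n \<D> (weight_matrix n \<D> i j)"
  proof (cases "i = j")
    case True
    \<comment> \<open>Here \<open>steps\<close> is 0, which no \<open>length w + 1\<close> can
      equal.\<close>
    then have "walks n \<D> i j = {}" by (simp add: walks_def steps_def)
    then show ?thesis using True by (simp add: weight_matrix_def psi_def)
  next
    case False
    let ?E = "insert i (arc {1..n} i j)" and ?E' = "insert j (arc {1..n} j i)"
    let ?A = "arc {1..n} i j" and ?A' = "arc {1..n} j i"
    let ?b = "\<lambda>a. \<lambda>\<alpha>\<in>\<D>. card \<alpha> - 2 - a \<alpha>"
    \<comment> \<open>The walk and its opposite together traverse every boundary edge exactly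
      once.\<close>
    have E: "{1..n} - ?E = ?E'" "?E \<subseteq> {1..n}"
      using ij False by (auto simp: arc_def split: if_splits)
    have compl: "complementary \<D> ?A ?A'"
      using dissection_dissected[OF assms] ij False by (intro complementary_arcs)
    have "psi n \<D> (weight_matrix n \<D> i j) = (\<Sum>a\<in>exponents \<D>. Poly_Mapping.single
        (monom_of \<D> (?b a) ?E') (int (num_assignments \<D> ?A' (?b a))))"
      unfolding weight_matrix_eq[OF fin ij False] psi_sum psi_single
    proof (rule sum.cong[OF refl])
      fix a assume "a \<in> exponents \<D>"
      then have "num_assignments \<D> ?A a = num_assignments \<D> ?A' (\<lambda>\<alpha>. card \<alpha> - 2 - a \<alpha>)"
        using compl by (auto simp: complementary_def exponents_def)
      also have "\<dots> = num_assignments \<D> ?A' (?b a)"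
        by (rule num_assignments_cong) simp
      finally show "Poly_Mapping.single (compl_monom n \<D> (monom_of \<D> a ?E)) (int (num_assignments \<D> ?A a)) =
          Poly_Mapping.single (monom_of \<D> (?b a) ?E') (int (num_assignments \<D> ?A' (?b a)))"
        unfolding compl_monom_monom_of[OF fin E(2)] E(1) by (simp add: monom_of_def)
    qed
    also have "\<dots> = (\<Sum>a\<in>exponents \<D>. Poly_Mapping.single
        (monom_of \<D> a ?E') (int (num_assignments \<D> ?A' a)))"
    proof (rule sum.reindex_bij_betw)
      \<comment> \<open>Complementing exponents is its own inverse; the restriction to
        \<open>\<D>\<close> keeps the vectors extensional.\<close>
      show "bij_betw ?b (exponents \<D>) (exponents \<D>)"
        by (rule bij_betw_byWitness[where f' = ?b])
          (auto simp: exponents_def PiE_iff extensional_def fun_eq_iff simp del: diff_diff_left)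
    qed
    also have "\<dots> = weight_matrix n \<D> j i"
      using weight_matrix_eq[OF fin ij(2,1)] False by simp
    finally show ?thesis by simp
  qed
qed

end
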